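(* Let $M$ be an $\omega$-complete effect monoid. Then there exist $\omega$-complete effect monoids $M_1$ and $M_2$ where $M_1$ is convex and $M_2$ is an $\omega$-complete Boolean algebra, such that $M$ embeds into $M_1\oplus M_2$.
   Context: An effect algebra is a set $E$ with an element $0$, a partial binary operation $a+b$ (the partial sum), and a total complement $a\mapsto a^\perp$, such that: the sum is commutative and associative wherever defined, $a+0=a$, $a^\perp$ is the unique element with $a+a^\perp=1$ where $1:=0^\perp$, and $a+1$ defined implies $a=0$. The order is $a\le b$ iff $b=a+c$ for some $c$. An effect monoid is an effect algebra with an associative total multiplication $\cdot$ with unit $1$ which distributes over the partial sum on both sides. It is $\omega$-complete if every increasing sequence has a supremum. An effect algebra $E$ is convex if there is an action $[0,1]\times E\to E$, $(\lambda,a)\mapsto\lambda a$, with $\lambda(\mu a)=(\lambda\mu)a$; if $\lambda+\mu\le1$ then $\lambda a+\mu a$ is defined and equals $(\lambda+\mu)a$; if $a+b$ is defined then $\lambda a+\lambda b$ is defined and equals $\lambda(a+b)$; and $1a=a$. A Boolean algebra is regarded as an effect monoid with $x+y$ defined iff $x\wedge y=0$ (then equal to $x\vee y$) and product $x\wedge y$. The direct sum $\oplus$ is the Cartesian product with componentwise operations. An embedding of effect monoids is a map preserving $1$, the partial sum and multiplication, which is order reflecting. *)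

theory Defs
  imports Complex_Main "HOL-Algebra.Lattice"
begin

section \<open>Effect algebras\<close>

text \<open>
  The partial sum is a relation \<open>orth\<close> (``the sum is defined'') together with an operation
  \<open>psum\<close> that is only ever used on arguments related by \<open>orth\<close>.
\<close>

record 'a effect_algebra = "'a partial_object" +
  ezero :: 'a  (\<open>\<zero>\<index>\<close>)
  orth :: "'a \<Rightarrow> 'a \<Rightarrow> bool"  (infix \<open>\<sharp>\<index>\<close> 50)
  psum :: "'a \<Rightarrow> 'a \<Rightarrow> 'a"  (infixl \<open>\<oplus>\<index>\<close> 65)
  ocompl :: "'a \<Rightarrow> 'a"

definition eone :: "('a, 'm) effect_algebra_scheme \<Rightarrow> 'a"  (\<open>\<one>\<index>\<close>)
  where "\<one>\<^bsub>E\<^esub> = ocompl E \<zero>\<^bsub>E\<^esub>"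

locale effect_algebra =
  fixes E :: "('a, 'm) effect_algebra_scheme" (structure)
  assumes zero_closed [simp]: "\<zero> \<in> carrier E"
    and ocompl_closed [simp]: "a \<in> carrier E \<Longrightarrow> ocompl E a \<in> carrier E"
    and psum_closed [simp]: "\<lbrakk>a \<in> carrier E; b \<in> carrier E; a \<sharp> b\<rbrakk> \<Longrightarrow> a \<oplus> b \<in> carrier E"
    and psum_comm: "\<lbrakk>a \<in> carrier E; b \<in> carrier E; a \<sharp> b\<rbrakk> \<Longrightarrow> b \<sharp> a \<and> a \<oplus> b = b \<oplus> a"
    and psum_assoc: "\<lbrakk>a \<in> carrier E; b \<in> carrier E; c \<in> carrier E; a \<sharp> b; a \<oplus> b \<sharp> c\<rbrakk>
          \<Longrightarrow> b \<sharp> c \<and> a \<sharp> b \<oplus> c \<and> (a \<oplus> b) \<oplus> c = a \<oplus> (b \<oplus> c)"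
    and psum_zero: "a \<in> carrier E \<Longrightarrow> a \<sharp> \<zero> \<and> a \<oplus> \<zero> = a"
    and psum_ocompl: "a \<in> carrier E \<Longrightarrow> a \<sharp> ocompl E a \<and> a \<oplus> ocompl E a = \<one>"
    and ocompl_unique: "\<lbrakk>a \<in> carrier E; b \<in> carrier E; a \<sharp> b; a \<oplus> b = \<one>\<rbrakk> \<Longrightarrow> b = ocompl E a"
    and orth_one: "\<lbrakk>a \<in> carrier E; a \<sharp> \<one>\<rbrakk> \<Longrightarrow> a = \<zero>"

definition effect_order :: "('a, 'm) effect_algebra_scheme \<Rightarrow> 'a gorder"
  where "effect_order E =
    \<lparr>carrier = carrier E, eq = (=),
     le = (\<lambda>a b. \<exists>c \<in> carrier E. a \<sharp>\<^bsub>E\<^esub> c \<and> b = a \<oplus>\<^bsub>E\<^esub> c)\<rparr>"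

definition omega_complete :: "('a, 'm) gorder_scheme \<Rightarrow> bool"
  where "omega_complete L \<longleftrightarrow>
    (\<forall>x :: nat \<Rightarrow> 'a. range x \<subseteq> carrier L \<and> (\<forall>n. x n \<sqsubseteq>\<^bsub>L\<^esub> x (Suc n))
      \<longrightarrow> (\<exists>s. least L s (Upper L (range x))))"

definition convex_effect_algebra :: "('a, 'm) effect_algebra_scheme \<Rightarrow> bool"
  where "convex_effect_algebra E \<longleftrightarrow> effect_algebra E \<and>
    (\<exists>act :: real \<Rightarrow> 'a \<Rightarrow> 'a.
      (\<forall>r \<in> {0..1}. \<forall>a \<in> carrier E. act r a \<in> carrier E) \<and>
      (\<forall>r \<in> {0..1}. \<forall>s \<in> {0..1}. \<forall>a \<in> carrier E. act r (act s a) = act (r * s) a) \<and>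
      (\<forall>r \<in> {0..1}. \<forall>s \<in> {0..1}. \<forall>a \<in> carrier E. r + s \<le> 1 \<longrightarrow>
        act r a \<sharp>\<^bsub>E\<^esub> act s a \<and> act r a \<oplus>\<^bsub>E\<^esub> act s a = act (r + s) a) \<and>
      (\<forall>r \<in> {0..1}. \<forall>a \<in> carrier E. \<forall>b \<in> carrier E. a \<sharp>\<^bsub>E\<^esub> b \<longrightarrow>
        act r a \<sharp>\<^bsub>E\<^esub> act r b \<and> act r a \<oplus>\<^bsub>E\<^esub> act r b = act r (a \<oplus>\<^bsub>E\<^esub> b)) \<and>
      (\<forall>a \<in> carrier E. act 1 a = a))"


section \<open>Effect monoids\<close>

record 'a effect_monoid = "'a effect_algebra" +
  emult :: "'a \<Rightarrow> 'a \<Rightarrow> 'a"  (infixl \<open>\<otimes>\<index>\<close> 70)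

locale effect_monoid = effect_algebra M for M :: "('a, 'm) effect_monoid_scheme" (structure) +
  assumes emult_closed [simp]: "\<lbrakk>a \<in> carrier M; b \<in> carrier M\<rbrakk> \<Longrightarrow> a \<otimes> b \<in> carrier M"
    and emult_assoc: "\<lbrakk>a \<in> carrier M; b \<in> carrier M; c \<in> carrier M\<rbrakk>
          \<Longrightarrow> (a \<otimes> b) \<otimes> c = a \<otimes> (b \<otimes> c)"
    and one_emult: "a \<in> carrier M \<Longrightarrow> \<one> \<otimes> a = a"
    and emult_one: "a \<in> carrier M \<Longrightarrow> a \<otimes> \<one> = a"
    and distrib_left: "\<lbrakk>a \<in> carrier M; b \<in> carrier M; c \<in> carrier M; b \<sharp> c\<rbrakk>
          \<Longrightarrow> a \<otimes> b \<sharp> a \<otimes> c \<and> a \<otimes> (b \<oplus> c) = a \<otimes> b \<oplus> a \<otimes> c"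
    and distrib_right: "\<lbrakk>a \<in> carrier M; b \<in> carrier M; c \<in> carrier M; b \<sharp> c\<rbrakk>
          \<Longrightarrow> b \<otimes> a \<sharp> c \<otimes> a \<and> (b \<oplus> c) \<otimes> a = b \<otimes> a \<oplus> c \<otimes> a"

definition direct_sum :: "'a effect_monoid \<Rightarrow> 'b effect_monoid \<Rightarrow> ('a \<times> 'b) effect_monoid"
  where "direct_sum M N =
    \<lparr>carrier = carrier M \<times> carrier N,
     ezero = (\<zero>\<^bsub>M\<^esub>, \<zero>\<^bsub>N\<^esub>),
     orth = (\<lambda>p q. fst p \<sharp>\<^bsub>M\<^esub> fst q \<and> snd p \<sharp>\<^bsub>N\<^esub> snd q),
     psum = (\<lambda>p q. (fst p \<oplus>\<^bsub>M\<^esub> fst q, snd p \<oplus>\<^bsub>N\<^esub> snd q)),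
     ocompl = (\<lambda>p. (ocompl M (fst p), ocompl N (snd p))),
     emult = (\<lambda>p q. (fst p \<otimes>\<^bsub>M\<^esub> fst q, snd p \<otimes>\<^bsub>N\<^esub> snd q))\<rparr>"

definition effect_monoid_embedding ::
    "('a, 'm) effect_monoid_scheme \<Rightarrow> ('b, 'n) effect_monoid_scheme \<Rightarrow> ('a \<Rightarrow> 'b) \<Rightarrow> bool"
  where "effect_monoid_embedding M N f \<longleftrightarrow>
    f \<in> carrier M \<rightarrow> carrier N \<and>
    f \<one>\<^bsub>M\<^esub> = \<one>\<^bsub>N\<^esub> \<and>
    (\<forall>a \<in> carrier M. \<forall>b \<in> carrier M. a \<sharp>\<^bsub>M\<^esub> b \<longrightarrow>
      f a \<sharp>\<^bsub>N\<^esub> f b \<and> f (a \<oplus>\<^bsub>M\<^esub> b) = f a \<oplus>\<^bsub>N\<^esub> f b) \<and>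
    (\<forall>a \<in> carrier M. \<forall>b \<in> carrier M. f (a \<otimes>\<^bsub>M\<^esub> b) = f a \<otimes>\<^bsub>N\<^esub> f b) \<and>
    (\<forall>a \<in> carrier M. \<forall>b \<in> carrier M.
      f a \<sqsubseteq>\<^bsub>effect_order N\<^esub> f b \<longrightarrow> a \<sqsubseteq>\<^bsub>effect_order M\<^esub> b)"


section \<open>Boolean algebras as effect monoids\<close>

text \<open>
  The type class of Boolean algebras is tied to whole types, so Boolean algebras on a carrier set
  are bounded distributive complemented lattices in the sense of \<^theory>\<open>HOL-Algebra.Lattice\<close>.
\<close>

locale boolean_algebra_on = bounded_lattice B for B :: "('a, 'm) gorder_scheme" (structure) +
  assumes meet_join_distrib: "\<lbrakk>x \<in> carrier B; y \<in> carrier B; z \<in> carrier B\<rbrakk>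
          \<Longrightarrow> x \<sqinter> (y \<squnion> z) = (x \<sqinter> y) \<squnion> (x \<sqinter> z)"
    and complemented: "x \<in> carrier B \<Longrightarrow> \<exists>y \<in> carrier B. x \<sqinter> y = \<bottom> \<and> x \<squnion> y = \<top>"

definition boolean_effect_monoid :: "('a, 'm) gorder_scheme \<Rightarrow> 'a effect_monoid"
  where "boolean_effect_monoid B =
    \<lparr>carrier = carrier B,
     ezero = \<bottom>\<^bsub>B\<^esub>,
     orth = (\<lambda>x y. x \<sqinter>\<^bsub>B\<^esub> y = \<bottom>\<^bsub>B\<^esub>),
     psum = (\<lambda>x y. x \<squnion>\<^bsub>B\<^esub> y),
     ocompl = (\<lambda>x. THE y. y \<in> carrier B \<and> x \<sqinter>\<^bsub>B\<^esub> y = \<bottom>\<^bsub>B\<^esub> \<and> x \<squnion>\<^bsub>B\<^esub> y = \<top>\<^bsub>B\<^esub>),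
     emult = (\<lambda>x y. x \<sqinter>\<^bsub>B\<^esub> y)\<rparr>"


context boolean_algebra_on
begin

lemma meet_comm': "x \<sqinter> y = y \<sqinter> x" and join_comm': "x \<squnion> y = y \<squnion> x"
  by (simp_all add: meet_def join_def insert_commute)

lemma meet_greatest': "\<lbrakk>x \<in> carrier B; y \<in> carrier B; z \<in> carrier B\<rbrakk> \<Longrightarrow> z \<sqsubseteq> x \<sqinter> y \<longleftrightarrow> z \<sqsubseteq> x \<and> z \<sqsubseteq> y"
  by (meson le_trans meet_closed meet_le meet_left meet_right)

lemma meet_assoc': "\<lbrakk>x \<in> carrier B; y \<in> carrier B; z \<in> carrier B\<rbrakk> \<Longrightarrow> (x \<sqinter> y) \<sqinter> z = x \<sqinter> (y \<sqinter> z)"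
  using weak_meet_assoc by (simp add: eq_is_equal)

lemma join_assoc': "\<lbrakk>x \<in> carrier B; y \<in> carrier B; z \<in> carrier B\<rbrakk> \<Longrightarrow> (x \<squnion> y) \<squnion> z = x \<squnion> (y \<squnion> z)"
  using weak_join_assoc by (simp add: eq_is_equal)

lemma join_bottom': "x \<in> carrier B \<Longrightarrow> x \<squnion> \<bottom> = x"
  by (metis bottom_closed bottom_lower join_comm' le_iff_meet)

lemma meet_bottom': "x \<in> carrier B \<Longrightarrow> x \<sqinter> \<bottom> = \<bottom>"
  by (metis bottom_closed bottom_lower meet_comm' le_iff_join)

lemma meet_top': "x \<in> carrier B \<Longrightarrow> x \<sqinter> \<top> = x"
  by (metis top_closed top_higher le_iff_join)

lemma bottom_join_bottom': "\<lbrakk>x \<in> carrier B; y \<in> carrier B\<rbrakk> \<Longrightarrow> x \<squnion> y = \<bottom> \<longleftrightarrow> x = \<bottom> \<and> y = \<bottom>"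
  by (metis bottom_closed bottom_lower join_bottom' join_left join_right le_antisym)

lemma complement_unique:
  assumes "x \<in> carrier B" "y \<in> carrier B" "z \<in> carrier B"
    and "x \<sqinter> y = \<bottom>" "x \<squnion> y = \<top>" "x \<sqinter> z = \<bottom>" "x \<squnion> z = \<top>"
  shows "y = z"
  by (metis assms join_bottom' join_comm' meet_closed meet_comm' meet_join_distrib meet_top')

lemma complement:
  assumes "x \<in> carrier B"
  defines "c \<equiv> THE y. y \<in> carrier B \<and> x \<sqinter> y = \<bottom> \<and> x \<squnion> y = \<top>"
  shows "c \<in> carrier B \<and> x \<sqinter> c = \<bottom> \<and> x \<squnion> c = \<top>"
  unfolding c_def by (rule theI') (metis assms(1) complemented complement_unique)

lemma bottom_join': "x \<in> carrier B \<Longrightarrow> \<bottom> \<squnion> x = x"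
  using join_bottom' by (simp add: join_comm'[of \<bottom>])

lemma complement_bottom: "(THE y. y \<in> carrier B \<and> \<bottom> \<sqinter> y = \<bottom> \<and> \<bottom> \<squnion> y = \<top>) = \<top>"
proof (rule the_equality)
  show "\<top> \<in> carrier B \<and> \<bottom> \<sqinter> \<top> = \<bottom> \<and> \<bottom> \<squnion> \<top> = \<top>"
    by (simp add: meet_top' bottom_join')
next
  fix y assume "y \<in> carrier B \<and> \<bottom> \<sqinter> y = \<bottom> \<and> \<bottom> \<squnion> y = \<top>"
  then show "y = \<top>" using bottom_join'[of y] by simp
qed

lemma effect_monoid_boolean: "effect_monoid (boolean_effect_monoid B)"
proof
  let ?M = "boolean_effect_monoid B"
  note d = boolean_effect_monoid_def eone_def complement_bottom
  show "\<zero>\<^bsub>?M\<^esub> \<in> carrier ?M" by (simp add: d)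
  show "ocompl ?M a \<in> carrier ?M" if "a \<in> carrier ?M" for a
    using complement[of a] that by (simp add: d)
  show "a \<oplus>\<^bsub>?M\<^esub> b \<in> carrier ?M" if "a \<in> carrier ?M" "b \<in> carrier ?M" for a b
    using that by (simp add: d)
  show "b \<sharp>\<^bsub>?M\<^esub> a \<and> a \<oplus>\<^bsub>?M\<^esub> b = b \<oplus>\<^bsub>?M\<^esub> a" if "a \<sharp>\<^bsub>?M\<^esub> b" for a b
    using that by (simp add: d meet_comm' join_comm')
  show "b \<sharp>\<^bsub>?M\<^esub> c \<and> a \<sharp>\<^bsub>?M\<^esub> b \<oplus>\<^bsub>?M\<^esub> c \<and> (a \<oplus>\<^bsub>?M\<^esub> b) \<oplus>\<^bsub>?M\<^esub> c = a \<oplus>\<^bsub>?M\<^esub> (b \<oplus>\<^bsub>?M\<^esub> c)"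
    if *: "a \<in> carrier ?M" "b \<in> carrier ?M" "c \<in> carrier ?M" "a \<sharp>\<^bsub>?M\<^esub> b" "a \<oplus>\<^bsub>?M\<^esub> b \<sharp>\<^bsub>?M\<^esub> c" for a b c
  proof -
    have abc: "a \<in> carrier B" "b \<in> carrier B" "c \<in> carrier B" using * by (simp_all add: d)
    have "(c \<sqinter> a) \<squnion> (c \<sqinter> b) = \<bottom>"
      using * abc by (simp add: d meet_comm'[of _ c] meet_join_distrib)
    then have "c \<sqinter> a = \<bottom>" "c \<sqinter> b = \<bottom>"
      using abc by (auto simp: bottom_join_bottom')
    then show ?thesis
      using * abc by (simp add: d meet_join_distrib meet_comm'[of _ c] join_assoc' bottom_join_bottom')
  qed
  show "a \<sharp>\<^bsub>?M\<^esub> \<zero>\<^bsub>?M\<^esub> \<and> a \<oplus>\<^bsub>?M\<^esub> \<zero>\<^bsub>?M\<^esub> = a" if "a \<in> carrier ?M" for a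
    using that by (simp add: d meet_bottom' join_bottom')
  show "a \<sharp>\<^bsub>?M\<^esub> ocompl ?M a \<and> a \<oplus>\<^bsub>?M\<^esub> ocompl ?M a = \<one>\<^bsub>?M\<^esub>" if "a \<in> carrier ?M" for a
    using complement[of a] that by (simp add: d)
  show "b = ocompl ?M a"
    if "a \<in> carrier ?M" "b \<in> carrier ?M" "a \<sharp>\<^bsub>?M\<^esub> b" "a \<oplus>\<^bsub>?M\<^esub> b = \<one>\<^bsub>?M\<^esub>" for a b
  proof -
    from that have "a \<in> carrier B" "b \<in> carrier B" "a \<sqinter> b = \<bottom>" "a \<squnion> b = \<top>"
      by (simp_all add: d)
    then have "b = (THE y. y \<in> carrier B \<and> a \<sqinter> y = \<bottom> \<and> a \<squnion> y = \<top>)"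
      using complement[of a] by (blast intro: complement_unique)
    then show ?thesis by (simp add: boolean_effect_monoid_def)
  qed
  show "a = \<zero>\<^bsub>?M\<^esub>" if "a \<in> carrier ?M" "a \<sharp>\<^bsub>?M\<^esub> \<one>\<^bsub>?M\<^esub>" for a
    using that by (simp add: d meet_top')
  show "a \<otimes>\<^bsub>?M\<^esub> b \<in> carrier ?M" if "a \<in> carrier ?M" "b \<in> carrier ?M" for a b
    using that by (simp add: d)
  show "(a \<otimes>\<^bsub>?M\<^esub> b) \<otimes>\<^bsub>?M\<^esub> c = a \<otimes>\<^bsub>?M\<^esub> (b \<otimes>\<^bsub>?M\<^esub> c)"
    if "a \<in> carrier ?M" "b \<in> carrier ?M" "c \<in> carrier ?M" for a b c
    using that by (simp add: d meet_assoc')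
  show "\<one>\<^bsub>?M\<^esub> \<otimes>\<^bsub>?M\<^esub> a = a" "a \<otimes>\<^bsub>?M\<^esub> \<one>\<^bsub>?M\<^esub> = a" if "a \<in> carrier ?M" for a
    using that by (simp_all add: d meet_top' meet_comm'[of \<top>])
  have orth: "(a \<sqinter> b) \<sqinter> (a \<sqinter> c) = \<bottom>"
    if *: "a \<in> carrier B" "b \<in> carrier B" "c \<in> carrier B" "b \<sqinter> c = \<bottom>" for a b c
  proof -
    have "(a \<sqinter> b) \<sqinter> (a \<sqinter> c) \<sqsubseteq> b"
      using * by (intro le_trans[OF meet_left meet_right]) auto
    moreover have "(a \<sqinter> b) \<sqinter> (a \<sqinter> c) \<sqsubseteq> c"
      using * by (intro le_trans[OF meet_right meet_right]) auto
    ultimately have "(a \<sqinter> b) \<sqinter> (a \<sqinter> c) \<sqsubseteq> \<bottom>"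
      using * meet_greatest'[of b c "(a \<sqinter> b) \<sqinter> (a \<sqinter> c)"] by simp
    then show ?thesis
      using * by (intro le_antisym) auto
  qed
  show "a \<otimes>\<^bsub>?M\<^esub> b \<sharp>\<^bsub>?M\<^esub> a \<otimes>\<^bsub>?M\<^esub> c \<and> a \<otimes>\<^bsub>?M\<^esub> (b \<oplus>\<^bsub>?M\<^esub> c) = a \<otimes>\<^bsub>?M\<^esub> b \<oplus>\<^bsub>?M\<^esub> a \<otimes>\<^bsub>?M\<^esub> c"
    "b \<otimes>\<^bsub>?M\<^esub> a \<sharp>\<^bsub>?M\<^esub> c \<otimes>\<^bsub>?M\<^esub> a \<and> (b \<oplus>\<^bsub>?M\<^esub> c) \<otimes>\<^bsub>?M\<^esub> a = b \<otimes>\<^bsub>?M\<^esub> a \<oplus>\<^bsub>?M\<^esub> c \<otimes>\<^bsub>?M\<^esub> a"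
    if "a \<in> carrier ?M" "b \<in> carrier ?M" "c \<in> carrier ?M" "b \<sharp>\<^bsub>?M\<^esub> c" for a b c
  proof -
    from that have *: "a \<in> carrier B" "b \<in> carrier B" "c \<in> carrier B" "b \<sqinter> c = \<bottom>"
      by (simp_all add: d)
    show "a \<otimes>\<^bsub>?M\<^esub> b \<sharp>\<^bsub>?M\<^esub> a \<otimes>\<^bsub>?M\<^esub> c \<and> a \<otimes>\<^bsub>?M\<^esub> (b \<oplus>\<^bsub>?M\<^esub> c) = a \<otimes>\<^bsub>?M\<^esub> b \<oplus>\<^bsub>?M\<^esub> a \<otimes>\<^bsub>?M\<^esub> c"
      using * by (simp add: d meet_join_distrib orth)
    then show "b \<otimes>\<^bsub>?M\<^esub> a \<sharp>\<^bsub>?M\<^esub> c \<otimes>\<^bsub>?M\<^esub> a \<and> (b \<oplus>\<^bsub>?M\<^esub> c) \<otimes>\<^bsub>?M\<^esub> a = b \<otimes>\<^bsub>?M\<^esub> a \<oplus>\<^bsub>?M\<^esub> c \<otimes>\<^bsub>?M\<^esub> a"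
      by (simp add: d meet_comm')
  qed
qed

lemma effect_order_boolean:
  assumes x: "x \<in> carrier B" and y: "y \<in> carrier B"
  shows "x \<sqsubseteq>\<^bsub>effect_order (boolean_effect_monoid B)\<^esub> y \<longleftrightarrow> x \<sqsubseteq> y"
proof
  assume "x \<sqsubseteq>\<^bsub>effect_order (boolean_effect_monoid B)\<^esub> y"
  then obtain c where "c \<in> carrier B" "y = x \<squnion> c"
    unfolding effect_order_def boolean_effect_monoid_def gorder.simps effect_algebra.simps
      partial_object.simps by blast
  then show "x \<sqsubseteq> y"
    using x by (simp only: join_left)
next
  assume le: "x \<sqsubseteq> y"
  obtain c where c: "c \<in> carrier B" "x \<sqinter> c = \<bottom>" "x \<squnion> c = \<top>"
    using complemented x by blast
  have yx: "y \<sqinter> x = x"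
    using iffD1[OF le_iff_join[OF x y] le, symmetric] by (simp only: meet_comm'[of y x])
  have "y \<sqinter> (x \<squnion> c) = (y \<sqinter> x) \<squnion> (y \<sqinter> c)"
    using y x c(1) by (rule meet_join_distrib)
  then have "y = x \<squnion> (y \<sqinter> c)"
    by (simp only: yx c(3) meet_top'[OF y])
  moreover have "x \<sqinter> (y \<sqinter> c) = \<bottom>"
    using meet_assoc'[OF x c(1) y] c(2) meet_bottom'[OF y]
    by (simp add: meet_comm'[of y c] meet_comm'[of \<bottom> y])
  moreover have "y \<sqinter> c \<in> carrier B" using y c by simp
  ultimately show "x \<sqsubseteq>\<^bsub>effect_order (boolean_effect_monoid B)\<^esub> y"
    unfolding effect_order_def boolean_effect_monoid_def gorder.simps effect_algebra.simps
      partial_object.simps by (intro bexI[of _ "y \<sqinter> c"] conjI)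
qed

end

lemma effect_monoid_direct_sum:
  fixes M :: "'a effect_monoid" and N :: "'b effect_monoid"
  assumes "effect_monoid M" "effect_monoid N"
  shows "effect_monoid (direct_sum M N)"
proof -
  interpret M: effect_monoid M by fact
  interpret N: effect_monoid N by fact
  note d = direct_sum_def eone_def
  show ?thesis
  proof (unfold_locales, goal_cases)
    case (4 a b)
    then show ?case
      using M.psum_comm[of "fst a" "fst b"] N.psum_comm[of "snd a" "snd b"]
      by (simp add: d mem_Times_iff)
  next
    case (5 a b c)
    then show ?case
      using M.psum_assoc[of "fst a" "fst b" "fst c"] N.psum_assoc[of "snd a" "snd b" "snd c"]
      by (simp add: d mem_Times_iff)
  next
    case (6 a)
    then show ?case
      using M.psum_zero[of "fst a"] N.psum_zero[of "snd a"]
      by (simp add: d mem_Times_iff)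
  next
    case (7 a)
    then show ?case
      using M.psum_ocompl[of "fst a"] N.psum_ocompl[of "snd a"]
      by (simp add: d mem_Times_iff)
  next
    case (8 a b)
    then show ?case
      using M.ocompl_unique[of "fst a" "fst b"] N.ocompl_unique[of "snd a" "snd b"]
      by (simp add: d mem_Times_iff prod_eq_iff)
  next
    case (9 a)
    then show ?case
      using M.orth_one[of "fst a"] N.orth_one[of "snd a"]
      by (simp add: d mem_Times_iff prod_eq_iff)
  next
    case (11 a b c)
    then show ?case
      using M.emult_assoc[of "fst a" "fst b" "fst c"] N.emult_assoc[of "snd a" "snd b" "snd c"]
      by (simp add: d mem_Times_iff)
  next
    case (12 a)
    then show ?case
      using M.one_emult[of "fst a"] N.one_emult[of "snd a"]
      by (simp add: d mem_Times_iff)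
  next
    case (13 a)
    then show ?case
      using M.emult_one[of "fst a"] N.emult_one[of "snd a"]
      by (simp add: d mem_Times_iff)
  next
    case (14 a b c)
    then show ?case
      using M.distrib_left[of "fst a" "fst b" "fst c"] N.distrib_left[of "snd a" "snd b" "snd c"]
      by (simp add: d mem_Times_iff)
  next
    case (15 a b c)
    then show ?case
      using M.distrib_right[of "fst a" "fst b" "fst c"] N.distrib_right[of "snd a" "snd b" "snd c"]
      by (simp add: d mem_Times_iff)
  qed (auto simp: d)
qed

end

theory Submission
  imports Defs "HOL-Library.FuncSet"
begin

text \<open>
  For an idempotent \<open>p\<close> the map \<open>a \<mapsto> p a\<close> is a homomorphism onto the corner \<open>p M\<close>, since
  \<open>p a p\<^sup>\<bottom> \<le> p p\<^sup>\<bottom> = 0\<close> makes idempotents central. The embedding maps \<open>M\<close> into the product of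
  all corners \<open>p M\<close> with \<open>p\<close> halvable (\<open>p = h + h\<close>, these are convex) and all corners \<open>p M\<close>
  consisting of idempotents (these are Boolean).

  To see that it reflects the order, decompose \<open>a = c + r\<close> and \<open>b = c + s\<close> with \<open>r s = 0\<close>. If
  \<open>q a \<le> q b\<close> for an idempotent \<open>q\<close>, then \<open>(q r)\<^sup>2 \<le> q r s = 0\<close>, and hence \<open>q r = 0\<close> because there
  are no nilpotents. So no nonzero idempotent of either kind lies below the ceiling \<open>p\<close> of \<open>r\<close>. But if
  \<open>x \<le> p\<close> is not idempotent, then \<open>x x\<^sup>\<bottom>\<close> is below both \<open>x\<close> and \<open>x\<^sup>\<bottom>\<close>, so it can be doubled, and the
  ceiling of its double is halvable. Therefore \<open>p = 0\<close> and \<open>a = c \<le> b\<close>. All corners of the two kinds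
  are used, so that no maximal orthogonal family has to be chosen.
\<close>

section \<open>Order and suprema in effect algebras\<close>

text \<open>Beyond the mere existence of suprema, omega-completeness acts through two facts.
  Multiplication preserves suprema of increasing sequences, although this is not assumed:
  \<open>a \<otimes> x\<close> and \<open>\<sim>a \<otimes> x\<close> add up to \<open>x\<close>, so
  neither can fall short in the limit. And an element that can be added again and again along an
  increasing sequence is zero; this excludes nilpotents, makes the remainders of a common part
  annihilate each other, and identifies the scalar 1 with the unit. Neither meets nor commutativity
  are available, so the order is tested through idempotents, which are central. Passing from a
  remainder to its ceiling does not change which elements annihilate it from the left. Formally the
  ceiling of \<open>c\<close> is the geometric series with first term \<open>c\<close> and ratio
  \<open>1 - c\<close>, the quotient \<open>c / c\<close>. If \<open>c = b + b\<close>, the same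
  series with first term \<open>b\<close> is \<open>b / c\<close>, one half of the ceiling: this is
  how doubling an element yields a halvable idempotent. A half of the unit gives dyadic fractions,
  their suprema give all scalars in [0,1], and these act by multiplication on the left.\<close>

context effect_algebra
begin

text \<open>Both relations include membership in the carrier, which removes most side conditions below.\<close>

definition summable_pair (infix \<open>\<diamondop>\<close> 50)
  where "a \<diamondop> b \<longleftrightarrow> a \<in> carrier E \<and> b \<in> carrier E \<and> a \<sharp> b"

definition leq (infix \<open>\<preceq>\<close> 50)
  where "a \<preceq> b \<longleftrightarrow> (\<exists>c. a \<diamondop> c \<and> b = a \<oplus> c)"

lemma one_closed [simp]: "\<one> \<in> carrier E"
  by (simp add: eone_def)

lemma pair_closed: "a \<diamondop> b \<Longrightarrow> a \<in> carrier E" "a \<diamondop> b \<Longrightarrow> b \<in> carrier E"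
    "a \<diamondop> b \<Longrightarrow> a \<oplus> b \<in> carrier E"
  by (auto simp: summable_pair_def)

lemma pair_comm: "a \<diamondop> b \<Longrightarrow> b \<diamondop> a" and sum_comm: "a \<diamondop> b \<Longrightarrow> a \<oplus> b = b \<oplus> a"
  using psum_comm[of a b] by (auto simp: summable_pair_def)

lemma pair_assoc:
  assumes "a \<diamondop> b" "a \<oplus> b \<diamondop> c"
  shows "b \<diamondop> c" "a \<diamondop> b \<oplus> c" "a \<oplus> b \<oplus> c = a \<oplus> (b \<oplus> c)"
  using assms psum_assoc[of a b c] by (auto simp: summable_pair_def)

text \<open>The axiom regroups only from left to right; commuting all summands turns it into the
  converse.\<close>

lemma pair_assoc':
  assumes "b \<diamondop> c" "a \<diamondop> b \<oplus> c"
  shows "a \<diamondop> b" "a \<oplus> b \<diamondop> c" "a \<oplus> b \<oplus> c = a \<oplus> (b \<oplus> c)"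
proof -
  have 1: "c \<diamondop> b" "c \<oplus> b = b \<oplus> c" "c \<oplus> b \<diamondop> a"
    using assms by (simp_all add: pair_comm sum_comm[of b c])
  note 2 = pair_assoc[OF 1(1,3)]
  show *: "a \<diamondop> b" "a \<oplus> b \<diamondop> c"
    using 2 by (metis pair_comm sum_comm)+
  show "a \<oplus> b \<oplus> c = a \<oplus> (b \<oplus> c)" using pair_assoc(3)[OF *] .
qed

lemma pair_zero: assumes "a \<in> carrier E"
  shows "a \<diamondop> \<zero>" "\<zero> \<diamondop> a" "a \<oplus> \<zero> = a" "\<zero> \<oplus> a = a"
proof -
  show *: "a \<diamondop> \<zero>" "a \<oplus> \<zero> = a" using assms psum_zero[of a] by (auto simp: summable_pair_def)
  show "\<zero> \<diamondop> a" "\<zero> \<oplus> a = a" using pair_comm[OF *(1)] sum_comm[OF *(1)] *(2) by simp_all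
qed

lemma pair_ocompl:
  assumes "a \<in> carrier E"
  shows "a \<diamondop> ocompl E a" "a \<oplus> ocompl E a = \<one>" "ocompl E a \<diamondop> a" "ocompl E a \<oplus> a = \<one>"
proof -
  show *: "a \<diamondop> ocompl E a" "a \<oplus> ocompl E a = \<one>"
    using assms psum_ocompl[of a] by (auto simp: summable_pair_def)
  show "ocompl E a \<diamondop> a" "ocompl E a \<oplus> a = \<one>"
    using pair_comm[OF *(1)] sum_comm[OF *(1)] *(2) by simp_all
qed

lemma ocompl_eqI: "\<lbrakk>a \<diamondop> b; a \<oplus> b = \<one>\<rbrakk> \<Longrightarrow> ocompl E a = b"
  using ocompl_unique[of a b] by (auto simp: summable_pair_def)

lemma ocompl_ocompl [simp]: "a \<in> carrier E \<Longrightarrow> ocompl E (ocompl E a) = a"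
  by (rule ocompl_eqI) (simp_all add: pair_ocompl)

lemma ocompl_zero: "ocompl E \<zero> = \<one>"
  by (simp add: eone_def)

text \<open>The complement of \<open>x\<close> equals
  \<open>a \<oplus> ocompl E (a \<oplus> x)\<close>, so it depends only on \<open>a\<close> and
  \<open>a \<oplus> x\<close>.\<close>

lemma sum_cancel:
  assumes "a \<diamondop> b" "a \<diamondop> c" "a \<oplus> b = a \<oplus> c"
  shows "b = c"
proof -
  have *: "ocompl E x = a \<oplus> ocompl E (a \<oplus> x)" if "a \<diamondop> x" for x
  proof -
    have 1: "x \<diamondop> a" "x \<oplus> a \<diamondop> ocompl E (a \<oplus> x)" "x \<oplus> a \<oplus> ocompl E (a \<oplus> x) = \<one>"
      using that by (simp_all add: pair_comm sum_comm[of x a] pair_ocompl pair_closed)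
    show ?thesis
      using pair_assoc[OF 1(1,2)] 1(3) by (intro ocompl_eqI) simp_all
  qed
  have "ocompl E b = ocompl E c" using *[OF assms(1)] *[OF assms(2)] assms(3) by simp
  then show ?thesis using ocompl_ocompl assms(1,2) pair_closed(2) by metis
qed

text \<open>Zero is summable with \<open>\<one>\<close>, hence so is the given sum, and
  associativity passes this on to \<open>b\<close>. Only zero is summable with
  \<open>\<one>\<close>.\<close>

lemma sum_eq_zero:
  assumes "a \<diamondop> b" "a \<oplus> b = \<zero>"
  shows "a = \<zero>" "b = \<zero>"
proof -
  have *: "b = \<zero>" if "a \<diamondop> b" "a \<oplus> b = \<zero>" for a b
  proof -
    have "a \<oplus> b \<diamondop> \<one>" using that by (simp add: pair_zero)
    then have "b \<diamondop> \<one>" using pair_assoc that by blast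
    then show ?thesis using orth_one by (auto simp: summable_pair_def)
  qed
  show "a = \<zero>" using *[of b a] assms by (simp add: pair_comm sum_comm)
  show "b = \<zero>" using * assms by blast
qed

lemma leq_closed: "a \<preceq> b \<Longrightarrow> a \<in> carrier E" "a \<preceq> b \<Longrightarrow> b \<in> carrier E"
  by (auto simp: leq_def pair_closed)

lemma leq_sum: "a \<diamondop> b \<Longrightarrow> a \<preceq> a \<oplus> b" "a \<diamondop> b \<Longrightarrow> b \<preceq> a \<oplus> b"
  unfolding leq_def by (blast, metis pair_comm sum_comm)

lemma leqE:
  assumes "a \<preceq> b" obtains c where "a \<diamondop> c" "b = a \<oplus> c"
  using assms by (auto simp: leq_def)

lemma leq_refl: "a \<in> carrier E \<Longrightarrow> a \<preceq> a"
  unfolding leq_def using pair_zero by metis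

lemma leq_trans: "\<lbrakk>a \<preceq> b; b \<preceq> c\<rbrakk> \<Longrightarrow> a \<preceq> c"
  by (auto elim!: leqE simp: pair_assoc(3) intro!: leq_sum dest: pair_assoc(2))

lemma leq_antisym:
  assumes "a \<preceq> b" "b \<preceq> a" shows "a = b"
proof -
  obtain c where c: "a \<diamondop> c" "b = a \<oplus> c" using assms(1) by (rule leqE)
  obtain d where d: "b \<diamondop> d" "a = b \<oplus> d" using assms(2) by (rule leqE)
  note 1 = pair_assoc[OF c(1) d(1)[unfolded c(2)], folded c(2)]
  have a: "a \<diamondop> \<zero>" "a \<oplus> \<zero> = a" using c(1) by (simp_all add: pair_zero pair_closed(1))
  have "a \<oplus> (c \<oplus> d) = a" using 1(3) d(2) by (rule trans[OF sym sym])
  then have "c \<oplus> d = \<zero>" by (intro sum_cancel[OF 1(2) a(1)] trans[OF _ a(2)[symmetric]])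
  then have "c = \<zero>" using sum_eq_zero(1)[OF 1(1)] by blast
  then show ?thesis using c(2) a(2) by simp
qed

lemma zero_leq: "a \<in> carrier E \<Longrightarrow> \<zero> \<preceq> a"
  unfolding leq_def using pair_zero by metis

lemma leq_one: "a \<in> carrier E \<Longrightarrow> a \<preceq> \<one>"
  unfolding leq_def using pair_ocompl by metis

lemma leq_zero: "a \<preceq> \<zero> \<Longrightarrow> a = \<zero>"
  using leq_antisym zero_leq leq_closed by blast

lemma pair_mono_right:
  assumes "a \<diamondop> c" "b \<preceq> c" shows "a \<diamondop> b" "a \<oplus> b \<preceq> a \<oplus> c"
proof -
  obtain d where d: "b \<diamondop> d" "c = b \<oplus> d" using assms(2) by (rule leqE)
  show "a \<diamondop> b" "a \<oplus> b \<preceq> a \<oplus> c"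
    using pair_assoc'[OF d(1)] d(2) assms(1) leq_sum(1)[of "a \<oplus> b" d] by auto
qed

lemma pair_mono:
  assumes "a \<preceq> a'" "b \<preceq> b'" "a' \<diamondop> b'" shows "a \<diamondop> b" "a \<oplus> b \<preceq> a' \<oplus> b'"
proof -
  have 1: "a' \<diamondop> b" "a' \<oplus> b \<preceq> a' \<oplus> b'" using pair_mono_right assms by blast+
  have 2: "b \<diamondop> a" "b \<oplus> a \<preceq> b \<oplus> a'"
    using pair_mono_right[OF pair_comm[OF 1(1)] assms(1)] .
  show "a \<diamondop> b" "a \<oplus> b \<preceq> a' \<oplus> b'"
    using 1 2 by (metis leq_trans pair_comm sum_comm)+
qed

lemma sum_cancel_leq:
  assumes "a \<diamondop> b" "a \<diamondop> c" "a \<oplus> b \<preceq> a \<oplus> c" shows "b \<preceq> c"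
proof -
  obtain d where d: "a \<oplus> b \<diamondop> d" "a \<oplus> c = a \<oplus> b \<oplus> d" using assms(3) by (rule leqE)
  have "b \<diamondop> d" "c = b \<oplus> d"
    using pair_assoc[OF assms(1) d(1)] d(2) sum_cancel[OF assms(2)] by auto
  then show ?thesis by (auto simp: leq_def)
qed

lemma pair_iff_leq_ocompl:
  assumes "a \<in> carrier E" "b \<in> carrier E"
  shows "a \<diamondop> b \<longleftrightarrow> b \<preceq> ocompl E a"
proof
  assume *: "a \<diamondop> b"
  show "b \<preceq> ocompl E a"
    using sum_cancel_leq[OF * pair_ocompl(1)[OF assms(1)]] leq_one[OF pair_closed(3)[OF *]]
    by (simp add: pair_ocompl assms)
next
  assume "b \<preceq> ocompl E a"
  then show "a \<diamondop> b" using pair_mono_right pair_ocompl assms by blast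
qed

lemma ocompl_antimono:
  assumes "a \<preceq> b" shows "ocompl E b \<preceq> ocompl E a"
  using assms pair_iff_leq_ocompl[of "ocompl E b" a] pair_iff_leq_ocompl[of a "ocompl E b"]
    leq_closed[OF assms] pair_comm by auto

lemma sum_exchange:
  assumes "a \<diamondop> b" "c \<diamondop> d" "a \<oplus> b \<diamondop> c \<oplus> d"
  shows "a \<diamondop> c" "b \<diamondop> d" "a \<oplus> c \<diamondop> b \<oplus> d" "(a \<oplus> b) \<oplus> (c \<oplus> d) = (a \<oplus> c) \<oplus> (b \<oplus> d)"
proof -
  note 1 = pair_assoc[OF assms(1,3)]
  note 2 = pair_assoc'[OF assms(2) 1(1)]
  have cb: "c \<diamondop> b" "b \<oplus> c = c \<oplus> b" using 2 by (simp_all add: pair_comm sum_comm[of b c])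
  have "c \<oplus> b \<diamondop> d" using 2 cb by simp
  note 3 = pair_assoc[OF cb(1) this]
  have "a \<diamondop> c \<oplus> (b \<oplus> d)" using 1 2 3 cb by simp
  note 4 = pair_assoc'[OF 3(2) this]
  show "a \<diamondop> c" "b \<diamondop> d" "a \<oplus> c \<diamondop> b \<oplus> d" "(a \<oplus> b) \<oplus> (c \<oplus> d) = (a \<oplus> c) \<oplus> (b \<oplus> d)"
    using 1 2 3 4 cb by simp_all
qed

section \<open>Suprema of increasing sequences\<close>

definition is_sup :: "'a \<Rightarrow> (nat \<Rightarrow> 'a) \<Rightarrow> bool"
  where "is_sup s x \<longleftrightarrow> (\<forall>n. x n \<preceq> s) \<and> (\<forall>u. (\<forall>n. x n \<preceq> u) \<longrightarrow> s \<preceq> u)"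

lemma is_sup_upper: "is_sup s x \<Longrightarrow> x n \<preceq> s"
  and is_sup_least: "is_sup s x \<Longrightarrow> (\<And>n. x n \<preceq> u) \<Longrightarrow> s \<preceq> u"
  by (auto simp: is_sup_def)

lemma is_sup_closed: "is_sup s x \<Longrightarrow> s \<in> carrier E" "is_sup s x \<Longrightarrow> x n \<in> carrier E"
  using is_sup_upper[of s x 0] is_sup_upper[of s x n] by (auto dest: leq_closed)

lemma is_sup_unique: "is_sup s x \<Longrightarrow> is_sup t x \<Longrightarrow> s = t"
  by (simp add: is_sup_def leq_antisym)

lemma leq_chain:
  assumes "\<And>n. x n \<preceq> x (Suc n)" "m \<le> n" shows "x m \<preceq> x n"
  using assms(2)
proof (induction rule: dec_induct)
  case base
  then show ?case using leq_refl[OF leq_closed(1)[OF assms(1)]] .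
next
  case (step k)
  show ?case using leq_trans[OF step.IH assms(1)] .
qed

text \<open>Since \<open>x \<preceq> u\<close>, the bound splits as \<open>u = x \<oplus> v\<close>;
  cancelling \<open>x\<close> makes \<open>v\<close> a bound of \<open>y\<close> alone. Definedness
  of \<open>x \<oplus> Y\<close> comes along with the inequality.\<close>

lemma is_sup_sum_leq:
  assumes "is_sup Y y" "\<And>n. x \<diamondop> y n" "\<And>n. x \<oplus> y n \<preceq> u"
  shows "x \<diamondop> Y" "x \<oplus> Y \<preceq> u"
proof -
  have "x \<preceq> u" using leq_trans[OF leq_sum(1)[OF assms(2)] assms(3)] .
  then obtain v where v: "x \<diamondop> v" "u = x \<oplus> v" by (rule leqE)
  have "Y \<preceq> v"
    using is_sup_least[OF assms(1)] sum_cancel_leq[OF assms(2) v(1)] assms(3) v(2) by simp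
  then show "x \<diamondop> Y" "x \<oplus> Y \<preceq> u"
    using pair_mono_right[OF v(1)] v(2) by simp_all
qed

text \<open>A bound of the diagonal sums bounds every mixed sum \<open>x n \<oplus> y m\<close>, as
  both terms grow up to the index \<open>max n m\<close>. The suprema can then be taken one variable
  at a time.\<close>

lemma is_sup_sum:
  assumes x: "is_sup X x" "\<And>n. x n \<preceq> x (Suc n)" and y: "is_sup Y y" "\<And>n. y n \<preceq> y (Suc n)"
    and xy: "\<And>n. x n \<diamondop> y n"
  shows "X \<diamondop> Y" "is_sup (X \<oplus> Y) (\<lambda>n. x n \<oplus> y n)"
proof -
  have *: "X \<diamondop> Y \<and> X \<oplus> Y \<preceq> u" if u: "\<And>n. x n \<oplus> y n \<preceq> u" for u
  proof -
    have 1: "x n \<diamondop> y m \<and> x n \<oplus> y m \<preceq> u" for n m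
    proof -
      have 1: "x n \<preceq> x (max n m)" "y m \<preceq> y (max n m)"
        using leq_chain[of x n "max n m"] leq_chain[of y m "max n m"] x(2) y(2) by simp_all
      show ?thesis
        using pair_mono[OF 1 xy] leq_trans[OF _ u] by simp
    qed
    have 2: "x n \<diamondop> Y \<and> x n \<oplus> Y \<preceq> u" for n
      using is_sup_sum_leq[OF y(1), of "x n" u] 1 by simp
    then have "Y \<diamondop> x n \<and> Y \<oplus> x n \<preceq> u" for n
      using pair_comm[of "x n" Y] sum_comm[of Y "x n"] by simp
    then have "Y \<diamondop> X \<and> Y \<oplus> X \<preceq> u"
      using is_sup_sum_leq[OF x(1), of Y u] by simp
    then show ?thesis using pair_comm[of Y X] sum_comm[of X Y] by simp
  qed
  \<comment> \<open>The trivial bound \<open>\<one>\<close> already forces the sum of the two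
    suprema to be defined.\<close>
  have "\<And>n. x n \<oplus> y n \<preceq> \<one>" using xy by (simp add: leq_one pair_closed)
  from *[OF this] show XY: "X \<diamondop> Y" by blast
  show "is_sup (X \<oplus> Y) (\<lambda>n. x n \<oplus> y n)"
    unfolding is_sup_def using * pair_mono[OF is_sup_upper[OF x(1)] is_sup_upper[OF y(1)] XY] by simp
qed

lemma is_sup_Suc:
  assumes "is_sup s x" "\<And>n. x n \<preceq> x (Suc n)" shows "is_sup s (\<lambda>n. x (Suc n))"
  unfolding is_sup_def
  using is_sup_upper[OF assms(1)] is_sup_least[OF assms(1)] leq_trans[OF assms(2)] by simp

lemma is_sup_const: "a \<in> carrier E \<Longrightarrow> is_sup a (\<lambda>n. a)"
  by (auto simp: is_sup_def leq_refl)

lemma effect_order_le_iff: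
  "\<lbrakk>a \<in> carrier E; b \<in> carrier E\<rbrakk> \<Longrightarrow> a \<sqsubseteq>\<^bsub>effect_order E\<^esub> b \<longleftrightarrow> a \<preceq> b"
  by (auto simp: effect_order_def leq_def summable_pair_def)

lemma least_Upper_iff_is_sup:
  assumes "range x \<subseteq> carrier E"
  shows "least (effect_order E) s (Upper (effect_order E) (range x)) \<longleftrightarrow> is_sup s x"
proof -
  have c: "carrier (effect_order E) = carrier E" by (simp add: effect_order_def)
  have U: "u \<in> Upper (effect_order E) (range x) \<longleftrightarrow> (\<forall>n. x n \<preceq> u)" for u
  proof -
    have "u \<in> Upper (effect_order E) (range x) \<longleftrightarrow>
        u \<in> carrier E \<and> (\<forall>n. x n \<sqsubseteq>\<^bsub>effect_order E\<^esub> u)"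
      using assms by (auto simp: Upper_def c)
    also have "\<dots> \<longleftrightarrow> u \<in> carrier E \<and> (\<forall>n. x n \<preceq> u)"
      using assms by (auto simp: effect_order_le_iff range_subsetD)
    finally show ?thesis using leq_closed(2) by auto
  qed
  have "least (effect_order E) s (Upper (effect_order E) (range x)) \<longleftrightarrow>
      (\<forall>n. x n \<preceq> s) \<and> (\<forall>u. (\<forall>n. x n \<preceq> u) \<longrightarrow> s \<sqsubseteq>\<^bsub>effect_order E\<^esub> u)"
    unfolding least_def by (auto simp: U Upper_closed[THEN subsetD])
  also have "\<dots> \<longleftrightarrow> is_sup s x"
    unfolding is_sup_def using leq_closed(2)[of "x 0"] by (auto simp: effect_order_le_iff)
  finally show ?thesis .
qed

lemma omega_complete_iff:
  "omega_complete (effect_order E) \<longleftrightarrow> (\<forall>x. (\<forall>n. x n \<preceq> x (Suc n)) \<longrightarrow> (\<exists>s. is_sup s x))"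
proof -
  have c: "carrier (effect_order E) = carrier E" by (simp add: effect_order_def)
  have "range x \<subseteq> carrier E \<and> (\<forall>n. x n \<sqsubseteq>\<^bsub>effect_order E\<^esub> x (Suc n)) \<longleftrightarrow> (\<forall>n. x n \<preceq> x (Suc n))" for x
  proof (cases "range x \<subseteq> carrier E")
    case True
    then show ?thesis by (auto simp: effect_order_le_iff range_subsetD)
  next
    case False
    then show ?thesis by (auto dest: leq_closed(1))
  qed
  moreover have "range x \<subseteq> carrier E" if "\<forall>n. x n \<preceq> x (Suc n)" for x
    using that by (auto dest: leq_closed(1))
  ultimately show ?thesis
    unfolding omega_complete_def c by (simp add: least_Upper_iff_is_sup cong: imp_cong)
qed

end


section \<open>Idempotents and ceilings in effect monoids\<close>

context effect_algebra
begin

abbreviation compl (\<open>\<sim>_\<close> [90] 90)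
  where "\<sim>a \<equiv> ocompl E a"

text \<open>This identifies a supremum known only from above: two elements below the two parts of a
  sum, with the same total, must be those parts.\<close>

lemma sum_squeeze:
  assumes "a \<preceq> a'" "b \<preceq> b'" "a' \<diamondop> b'" "a \<oplus> b = a' \<oplus> b'"
  shows "a = a'"
proof -
  note 1 = pair_mono_right[OF assms(3,2)]
  have 2: "a \<diamondop> b" using pair_mono[OF assms(1-3)] by simp
  have "b \<oplus> a' \<preceq> b \<oplus> a"
    using 1 2 assms(4) sum_comm[of b a'] sum_comm[of b a] pair_comm[of a b] pair_comm[of a' b] by simp
  then have "a' \<preceq> a"
    using sum_cancel_leq[of b a' a] 1 2 by (simp add: pair_comm)
  then show ?thesis using leq_antisym assms(1) by blast
qed

end

context effect_monoid
begin

notation summable_pair (infix \<open>\<diamondop>\<close> 50) and leq (infix \<open>\<preceq>\<close> 50) and compl (\<open>\<sim>_\<close> [90] 90)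

lemma mult_pair_left:
  assumes "a \<in> carrier M" "b \<diamondop> c"
  shows "a \<otimes> b \<diamondop> a \<otimes> c" "a \<otimes> (b \<oplus> c) = a \<otimes> b \<oplus> a \<otimes> c"
  using assms distrib_left[of a b c] by (auto simp: summable_pair_def)

lemma mult_pair_right:
  assumes "a \<in> carrier M" "b \<diamondop> c"
  shows "b \<otimes> a \<diamondop> c \<otimes> a" "(b \<oplus> c) \<otimes> a = b \<otimes> a \<oplus> c \<otimes> a"
  using assms distrib_right[of a b c] by (auto simp: summable_pair_def)

lemma mult_zero [simp]:
  assumes "a \<in> carrier M" shows "a \<otimes> \<zero> = \<zero>" "\<zero> \<otimes> a = \<zero>"
proof -
  have z: "\<zero> \<diamondop> \<zero>" "\<zero> \<oplus> \<zero> = \<zero>" by (simp_all add: pair_zero)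
  show "a \<otimes> \<zero> = \<zero>"
    using mult_pair_left[OF assms z(1)] z(2) sum_cancel[of "a \<otimes> \<zero>" "a \<otimes> \<zero>" \<zero>] assms
    by (simp add: pair_zero)
  show "\<zero> \<otimes> a = \<zero>"
    using mult_pair_right[OF assms z(1)] z(2) sum_cancel[of "\<zero> \<otimes> a" "\<zero> \<otimes> a" \<zero>] assms
    by (simp add: pair_zero)
qed

lemma mult_mono_left:
  assumes "a \<in> carrier M" "b \<preceq> c" shows "a \<otimes> b \<preceq> a \<otimes> c"
  using assms(2) by (auto elim!: leqE simp: mult_pair_left[OF assms(1)] intro!: leq_sum)

lemma mult_mono_right:
  assumes "a \<in> carrier M" "b \<preceq> c" shows "b \<otimes> a \<preceq> c \<otimes> a"
  using assms(2) by (auto elim!: leqE simp: mult_pair_right[OF assms(1)] intro!: leq_sum)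

lemma emult_mono:
  assumes "a \<preceq> a'" "b \<preceq> b'" shows "a \<otimes> b \<preceq> a' \<otimes> b'"
  using leq_trans[OF mult_mono_left[OF _ assms(2)] mult_mono_right[OF _ assms(1)]] assms
  by (simp add: leq_closed)

lemma mult_leq:
  assumes "a \<in> carrier M" "b \<in> carrier M" shows "a \<otimes> b \<preceq> a" "a \<otimes> b \<preceq> b"
  using mult_mono_left[OF assms(1) leq_one[OF assms(2)]]
    mult_mono_right[OF assms(2) leq_one[OF assms(1)]] assms
  by (simp_all add: emult_one one_emult)

lemma mult_split_left:
  assumes "a \<in> carrier M" "b \<in> carrier M"
  shows "a \<otimes> b \<diamondop> \<sim>a \<otimes> b" "a \<otimes> b \<oplus> \<sim>a \<otimes> b = b"
  using mult_pair_right[OF assms(2) pair_ocompl(1)[OF assms(1)]] assms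
  by (simp_all add: pair_ocompl one_emult)

lemma mult_split_right:
  assumes "a \<in> carrier M" "b \<in> carrier M"
  shows "b \<otimes> a \<diamondop> b \<otimes> \<sim>a" "b \<otimes> a \<oplus> b \<otimes> \<sim>a = b"
  using mult_pair_left[OF assms(2) pair_ocompl(1)[OF assms(1)]] assms
  by (simp_all add: pair_ocompl emult_one)

text \<open>In \<open>b = a \<otimes> b \<oplus> \<sim>a \<otimes> b\<close> the first term
  vanishes, so \<open>b\<close> lies below \<open>\<sim>a\<close>.\<close>

lemma pair_if_mult_eq_zero:
  assumes "a \<in> carrier M" "b \<in> carrier M" "a \<otimes> b = \<zero>" shows "a \<diamondop> b"
proof -
  have "b = \<sim>a \<otimes> b" using mult_split_left[OF assms(1,2)] assms by (simp add: pair_zero)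
  then have "b \<preceq> \<sim>a" using mult_leq(1)[of "\<sim>a" b] assms by simp
  then show ?thesis using pair_iff_leq_ocompl assms by blast
qed

definition idem :: "'a \<Rightarrow> bool"
  where "idem p \<longleftrightarrow> p \<in> carrier M \<and> p \<otimes> p = p"

lemma idem_closed [simp, intro]: "idem p \<Longrightarrow> p \<in> carrier M"
  by (simp add: idem_def)

text \<open>Multiplying \<open>p\<close> by itself and by its complement, on either side, splits
  \<open>p\<close> into \<open>p \<otimes> p\<close> and the product in question.\<close>

lemma idem_iff_mult_compl:
  assumes "p \<in> carrier M"
  shows "idem p \<longleftrightarrow> p \<otimes> \<sim>p = \<zero>" "idem p \<longleftrightarrow> \<sim>p \<otimes> p = \<zero>"
proof -
  have cl: "p \<otimes> p \<in> carrier M" using assms by simp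
  have *: "p \<otimes> p = p \<longleftrightarrow> x = \<zero>" if x: "p \<otimes> p \<diamondop> x" "p \<otimes> p \<oplus> x = p" for x
  proof
    assume pp: "p \<otimes> p = p"
    show "x = \<zero>"
      using sum_cancel[OF x(1) pair_zero(1)[OF cl]] x(2) by (simp add: pp pair_zero assms)
  next
    assume "x = \<zero>"
    then show "p \<otimes> p = p" using x(2) cl by (simp add: pair_zero)
  qed
  show "idem p \<longleftrightarrow> p \<otimes> \<sim>p = \<zero>" "idem p \<longleftrightarrow> \<sim>p \<otimes> p = \<zero>"
    using *[OF mult_split_left[OF assms assms]] *[OF mult_split_right[OF assms assms]] assms
    by (simp_all add: idem_def)
qed

lemma idem_compl:
  assumes "idem p" shows "idem (\<sim>p)"
proof -
  have p: "p \<in> carrier M" using assms by (rule idem_closed)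
  have "\<sim>p \<otimes> \<sim>(\<sim>p) = \<zero>" using idem_iff_mult_compl(2)[OF p] assms p by simp
  then show ?thesis using idem_iff_mult_compl(1)[OF ocompl_closed[OF p]] by blast
qed

lemma idem_sandwich:
  assumes "idem p" "a \<in> carrier M" shows "p \<otimes> a \<otimes> \<sim>p = \<zero>" "\<sim>p \<otimes> a \<otimes> p = \<zero>"
proof -
  have *: "q \<otimes> a \<otimes> \<sim>q = \<zero>" if "idem q" for q
  proof -
    have "q \<otimes> a \<otimes> \<sim>q \<preceq> q \<otimes> \<sim>q"
      using mult_mono_right[OF _ mult_leq(1)[of q a], of "\<sim>q"] that assms by simp
    also have "q \<otimes> \<sim>q = \<zero>" using idem_iff_mult_compl(1)[of q] that by blast
    finally show ?thesis by (rule leq_zero)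
  qed
  show "p \<otimes> a \<otimes> \<sim>p = \<zero>" "\<sim>p \<otimes> a \<otimes> p = \<zero>"
    using *[OF assms(1)] *[OF idem_compl[OF assms(1)]] assms by simp_all
qed

lemma idem_central:
  assumes "idem p" "a \<in> carrier M" shows "p \<otimes> a = a \<otimes> p"
proof -
  have "p \<otimes> a = p \<otimes> a \<otimes> p"
    using mult_split_right(2)[of p "p \<otimes> a"] idem_sandwich[OF assms] assms
    by (simp add: pair_zero)
  moreover have "a \<otimes> p = p \<otimes> a \<otimes> p"
    using mult_split_left(2)[of p "a \<otimes> p"] idem_sandwich(2)[OF assms] assms
    by (simp add: pair_zero emult_assoc)
  ultimately show ?thesis by simp
qed

lemma idem_leq_iff:
  assumes "idem p" "a \<in> carrier M" shows "a \<preceq> p \<longleftrightarrow> p \<otimes> a = a"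
proof
  assume "a \<preceq> p"
  then have "\<sim>p \<otimes> a \<preceq> \<sim>p \<otimes> p"
    using mult_mono_left[of "\<sim>p" a p] assms by simp
  also have "\<sim>p \<otimes> p = \<zero>" using idem_iff_mult_compl(2)[of p] assms by blast
  finally have "\<sim>p \<otimes> a \<preceq> \<zero>" .
  then show "p \<otimes> a = a"
    using mult_split_left(2)[of p a] leq_zero[of "\<sim>p \<otimes> a"] assms by (simp add: pair_zero)
next
  assume "p \<otimes> a = a"
  then show "a \<preceq> p" using mult_leq(1)[of p a] assms by simp
qed

lemma idem_mult_mult:
  assumes "idem p" "a \<in> carrier M" "b \<in> carrier M"
  shows "p \<otimes> (a \<otimes> b) = (p \<otimes> a) \<otimes> (p \<otimes> b)"
proof -
  have "(p \<otimes> a) \<otimes> (p \<otimes> b) = p \<otimes> (a \<otimes> p) \<otimes> b"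
    using assms by (simp add: emult_assoc)
  also have "\<dots> = (p \<otimes> p) \<otimes> (a \<otimes> b)"
    using assms by (simp add: idem_central[OF assms(1,2), symmetric] emult_assoc)
  finally show ?thesis using assms by (simp add: idem_def)
qed

end

section \<open>Consequences of omega-completeness for the product and for idempotents\<close>

locale omega_effect_monoid = effect_monoid M for M :: "('a, 'm) effect_monoid_scheme" (structure) +
  assumes omega: "omega_complete (effect_order M)"
begin

lemma sup_exists:
  assumes "\<And>n. x n \<preceq> x (Suc n)" obtains s where "is_sup s x"
  using omega assms unfolding omega_complete_iff by blast

text \<open>The supremum \<open>s\<close> of \<open>y\<close> bounds all
  \<open>y n \<oplus> x\<close>, hence \<open>x \<oplus> s \<preceq> s\<close>. This is an equality,
  and \<open>s\<close> cancels.\<close>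

lemma archimedean:
  assumes "\<And>n. y n \<diamondop> x" "\<And>n. y n \<oplus> x \<preceq> y (Suc n)" shows "x = \<zero>"
proof -
  have "\<And>n. y n \<preceq> y (Suc n)" using leq_trans[OF leq_sum(1)[OF assms(1)] assms(2)] .
  then obtain s where s: "is_sup s y" by (rule sup_exists)
  have ys: "y n \<oplus> x \<preceq> s" for n using leq_trans[OF assms(2) is_sup_upper[OF s]] .
  have xy: "x \<diamondop> y n" "x \<oplus> y n \<preceq> s" for n
    using ys assms(1) pair_comm[of "y n" x] sum_comm[of x "y n"] by simp_all
  have xs: "x \<diamondop> s" "x \<oplus> s \<preceq> s" using is_sup_sum_leq[OF s xy] by simp_all
  then have "x \<oplus> s = s" using leq_antisym leq_sum(2)[OF xs(1)] by blast
  then show ?thesis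
    using sum_cancel[of s x \<zero>] xs(1) sum_comm[of s x] pair_comm[of x s] pair_closed[of x s]
    by (simp add: pair_zero)
qed

text \<open>Let \<open>X\<close> and \<open>Y\<close> be the suprema of
  \<open>a \<otimes> b n\<close> and \<open>\<sim>a \<otimes> b n\<close>. They lie below
  \<open>a \<otimes> B\<close> and \<open>\<sim>a \<otimes> B\<close>, but their sum is the supremum
  of \<open>b n\<close>, which is \<open>B\<close>, the sum of these two bounds. So neither bound is
  missed; the right-hand version is symmetric.\<close>

lemma is_sup_mult:
  assumes a: "a \<in> carrier M" and b: "is_sup B b" "\<And>n. b n \<preceq> b (Suc n)"
  shows "is_sup (a \<otimes> B) (\<lambda>n. a \<otimes> b n)" "is_sup (B \<otimes> a) (\<lambda>n. b n \<otimes> a)"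
proof -
  have na: "\<sim>a \<in> carrier M" using a by simp
  have cb: "b n \<in> carrier M" "B \<in> carrier M" for n using is_sup_closed[OF b(1)] by simp_all
  note inc = mult_mono_left[OF a b(2)] mult_mono_left[OF na b(2)]
    mult_mono_right[OF a b(2)] mult_mono_right[OF na b(2)]
  {
    obtain X where X: "is_sup X (\<lambda>n. a \<otimes> b n)"
      using sup_exists[of "\<lambda>n. a \<otimes> b n"] inc(1) by blast
    obtain Y where Y: "is_sup Y (\<lambda>n. \<sim>a \<otimes> b n)"
      using sup_exists[of "\<lambda>n. \<sim>a \<otimes> b n"] inc(2) by blast
    have "X \<diamondop> Y" "is_sup (X \<oplus> Y) (\<lambda>n. a \<otimes> b n \<oplus> \<sim>a \<otimes> b n)"
      using is_sup_sum[OF X inc(1) Y inc(2)] mult_split_left(1)[OF a cb(1)] by blast+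
    then have XY: "X \<oplus> Y = B"
      using is_sup_unique[OF _ b(1), of "X \<oplus> Y"] by (simp add: mult_split_left(2)[OF a cb(1)])
    have "X \<preceq> a \<otimes> B" "Y \<preceq> \<sim>a \<otimes> B"
      using mult_mono_left[OF a is_sup_upper[OF b(1)]] mult_mono_left[OF na is_sup_upper[OF b(1)]]
      by (auto intro: is_sup_least[OF X] is_sup_least[OF Y])
    then have "X = a \<otimes> B"
      using sum_squeeze[OF _ _ mult_split_left(1)[OF a cb(2)], of X Y] XY mult_split_left(2)[OF a cb(2)]
      by simp
    then show "is_sup (a \<otimes> B) (\<lambda>n. a \<otimes> b n)" using X by simp
  }
  {
    obtain X where X: "is_sup X (\<lambda>n. b n \<otimes> a)"
      using sup_exists[of "\<lambda>n. b n \<otimes> a"] inc(3) by blast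
    obtain Y where Y: "is_sup Y (\<lambda>n. b n \<otimes> \<sim>a)"
      using sup_exists[of "\<lambda>n. b n \<otimes> \<sim>a"] inc(4) by blast
    have "X \<diamondop> Y" "is_sup (X \<oplus> Y) (\<lambda>n. b n \<otimes> a \<oplus> b n \<otimes> \<sim>a)"
      using is_sup_sum[OF X inc(3) Y inc(4)] mult_split_right(1)[OF a cb(1)] by blast+
    then have XY: "X \<oplus> Y = B"
      using is_sup_unique[OF _ b(1), of "X \<oplus> Y"] by (simp add: mult_split_right(2)[OF a cb(1)])
    have "X \<preceq> B \<otimes> a" "Y \<preceq> B \<otimes> \<sim>a"
      using mult_mono_right[OF a is_sup_upper[OF b(1)]] mult_mono_right[OF na is_sup_upper[OF b(1)]]
      by (auto intro: is_sup_least[OF X] is_sup_least[OF Y])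
    then have "X = B \<otimes> a"
      using sum_squeeze[OF _ _ mult_split_right(1)[OF a cb(2)], of X Y] XY mult_split_right(2)[OF a cb(2)]
      by simp
    then show "is_sup (B \<otimes> a) (\<lambda>n. b n \<otimes> a)" using X by simp
  }
qed

text \<open>A square-zero element can be doubled, and its double again squares to zero.\<close>

lemma square_eq_zero:
  assumes "x \<in> carrier M" "x \<otimes> x = \<zero>" shows "x = \<zero>"
proof -
  define z where "z = rec_nat x (\<lambda>_ y. y \<oplus> y)"
  have z0: "z 0 = x" and zS: "z (Suc n) = z n \<oplus> z n" for n by (simp_all add: z_def)
  have *: "z n \<in> carrier M \<and> z n \<otimes> z n = \<zero> \<and> z n \<diamondop> z n \<and> x \<preceq> z n" for n
  proof (induction n)
    case 0
    then show ?case using assms by (simp add: z0 leq_refl pair_if_mult_eq_zero)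
  next
    case (Suc n)
    then have d: "z n \<diamondop> z n" and c: "z n \<in> carrier M" and zz: "z n \<otimes> z n = \<zero>" by auto
    have c': "z n \<oplus> z n \<in> carrier M" using d by (rule pair_closed)
    have "(z n \<oplus> z n) \<otimes> (z n \<oplus> z n) = \<zero>"
      using mult_pair_left(2)[OF c' d] mult_pair_right(2)[OF c d] zz by (simp add: pair_zero)
    then show ?case
      using c' Suc leq_trans[of x "z n"] leq_sum(1)[OF d] by (simp add: zS pair_if_mult_eq_zero)
  qed
  show ?thesis
  proof (rule archimedean[of z])
    fix n
    have d: "z n \<diamondop> z n" and x: "x \<preceq> z n" using * by blast+
    show "z n \<diamondop> x" "z n \<oplus> x \<preceq> z (Suc n)" using pair_mono_right[OF d x] by (simp_all add: zS)
  qed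
qed

text \<open>For \<open>b = c\<close> the supremum of \<open>geom b c\<close> is the least idempotent above \<open>c\<close>.\<close>

primrec geom :: "'a \<Rightarrow> 'a \<Rightarrow> nat \<Rightarrow> 'a" where
  "geom b c 0 = \<zero>"
| "geom b c (Suc n) = b \<oplus> geom b c n \<otimes> \<sim>c"

text \<open>\<open>geom b c n\<close> is the geometric sum of \<open>b\<close> times the powers of
  \<open>\<sim>c\<close> with exponents below \<open>n\<close>. Each addition is defined because
  \<open>b \<preceq> c\<close> while the other summand lies below \<open>\<sim>c\<close>.\<close>

lemma geom:
  assumes "b \<preceq> c"
  shows "geom b c n \<in> carrier M" "b \<diamondop> geom b c n \<otimes> \<sim>c" "geom b c n \<preceq> geom b c (Suc n)"
proof -
  have bc: "b \<in> carrier M" "c \<in> carrier M" "\<sim>c \<in> carrier M"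
    using leq_closed[OF assms] by simp_all
  have p: "b \<diamondop> x \<otimes> \<sim>c" if "x \<in> carrier M" for x
    using pair_mono(1)[OF assms mult_leq(2)[OF that bc(3)]] pair_ocompl(1) bc by simp
  show c: "geom b c n \<in> carrier M" for n
    by (induction n) (simp_all add: p pair_closed)
  show "b \<diamondop> geom b c n \<otimes> \<sim>c" by (simp add: p c)
  show "geom b c n \<preceq> geom b c (Suc n)"
  proof (induction n)
    case 0
    then show ?case using c[of "Suc 0"] by (simp add: zero_leq)
  next
    case (Suc n)
    then show ?case
      using pair_mono(2)[OF leq_refl[OF bc(1)] mult_mono_right[OF bc(3) Suc] p[OF c]] by simp
  qed
qed

text \<open>Every term of the series begins with the factor \<open>c\<close>, so \<open>q\<close>
  kills all partial sums and, since products preserve suprema, their limit. Minimality of the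
  ceiling is used only in this form.\<close>

lemma mult_ceiling:
  assumes "is_sup p (geom c c)" "c \<in> carrier M" "q \<in> carrier M" "q \<otimes> c = \<zero>"
  shows "q \<otimes> p = \<zero>"
proof -
  note g = geom[OF leq_refl[OF assms(2)]]
  have "q \<otimes> geom c c n = \<zero>" for n
  proof (induction n)
    case (Suc n)
    then show ?case
      using mult_pair_left(2)[OF assms(3) g(2)] assms g(1) emult_assoc[of q "geom c c n" "\<sim>c"]
      by (simp add: pair_zero)
  qed (use assms in simp)
  moreover have "is_sup (q \<otimes> p) (\<lambda>n. q \<otimes> geom c c n)"
    using is_sup_mult(1)[OF assms(3,1)] g(3) by simp
  ultimately show ?thesis using is_sup_unique is_sup_const[of \<zero>] by auto
qed

text \<open>In the limit the recursion becomes \<open>p = c \<oplus> p \<otimes> \<sim>c\<close>.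
  Adding \<open>\<sim>p \<otimes> \<sim>c\<close> gives \<open>c \<oplus> \<sim>c\<close>, the unit,
  so \<open>\<sim>p = \<sim>p \<otimes> \<sim>c\<close>. Thus \<open>\<sim>p\<close> annihilates
  \<open>c\<close>, and therefore also \<open>p\<close>.\<close>

lemma ceiling:
  assumes "is_sup p (geom c c)" "c \<in> carrier M"
  shows "idem p" "c \<preceq> p"
proof -
  note g = geom[OF leq_refl[OF assms(2)]]
  note p = is_sup_closed(1)[OF assms(1)]
  let ?f = "\<sim>p"
  have inc: "geom c c n \<otimes> \<sim>c \<preceq> geom c c (Suc n) \<otimes> \<sim>c" for n
    using mult_mono_right[OF _ g(3)] assms by simp
  have s: "is_sup (p \<otimes> \<sim>c) (\<lambda>n. geom c c n \<otimes> \<sim>c)"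
    using is_sup_mult(2)[OF _ assms(1) g(3)] assms by simp
  have "is_sup (c \<oplus> p \<otimes> \<sim>c) (\<lambda>n. geom c c (Suc n))" and d: "c \<diamondop> p \<otimes> \<sim>c"
    using is_sup_sum[OF is_sup_const[OF assms(2)] leq_refl[OF assms(2)] s inc g(2)] by simp_all
  then have pc: "c \<oplus> p \<otimes> \<sim>c = p"
    using is_sup_unique[OF _ is_sup_Suc[OF assms(1) g(3)]] by blast
  have fc: "p \<otimes> \<sim>c \<diamondop> ?f \<otimes> \<sim>c" "p \<otimes> \<sim>c \<oplus> ?f \<otimes> \<sim>c = \<sim>c"
    using mult_split_left[of p "\<sim>c"] p assms by simp_all
  have "p \<diamondop> ?f \<otimes> \<sim>c" "p \<oplus> ?f \<otimes> \<sim>c = \<one>"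
    using pair_assoc'[OF fc(1), of c] fc(2) pair_ocompl assms(2) pc by simp_all
  then have f: "?f = ?f \<otimes> \<sim>c" by (rule ocompl_eqI)
  have "?f \<otimes> c = \<zero>"
    using mult_split_right[of c ?f] f[symmetric] sum_cancel[of ?f "?f \<otimes> c" \<zero>]
      sum_comm[of "?f \<otimes> c" ?f] pair_comm[of "?f \<otimes> c" ?f] p assms
    by (simp add: pair_zero)
  then have "?f \<otimes> p = \<zero>" using mult_ceiling[OF assms] p by simp
  then show "idem p" using idem_iff_mult_compl(2)[OF p] by blast
  have "geom c c (Suc 0) = c" using assms by (simp add: pair_zero)
  then show "c \<preceq> p" using is_sup_upper[OF assms(1), of "Suc 0"] by simp
qed

lemma ceiling_exists:
  assumes "c \<in> carrier M" obtains p where "is_sup p (geom c c)"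
  using sup_exists[of "geom c c"] geom(3)[OF leq_refl[OF assms]] by blast

definition halvable :: "'a \<Rightarrow> bool"
  where "halvable p \<longleftrightarrow> (\<exists>h. h \<diamondop> h \<and> p = h \<oplus> h)"

text \<open>The series with first term \<open>b\<close> and ratio
  \<open>\<sim>(b \<oplus> b)\<close>, doubled term by term, is the series of the ceiling of
  \<open>b \<oplus> b\<close>. Its supremum is therefore a half of that ceiling.\<close>

lemma halvable_ceiling:
  assumes b: "b \<diamondop> b" and p: "is_sup p (geom (b \<oplus> b) (b \<oplus> b))"
  shows "halvable p"
proof -
  let ?c = "b \<oplus> b"
  have c: "\<sim>?c \<in> carrier M" using pair_closed(3)[OF b] by simp
  note g = geom[OF leq_sum(1)[OF b]]
  have *: "geom b ?c n \<diamondop> geom b ?c n \<and> geom b ?c n \<oplus> geom b ?c n = geom ?c ?c n" for n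
  proof (induction n)
    case 0
    then show ?case by (simp add: pair_zero)
  next
    case (Suc n)
    let ?H = "geom b ?c n \<otimes> \<sim>?c"
    have H: "?H \<diamondop> ?H" "?H \<oplus> ?H = geom ?c ?c n \<otimes> \<sim>?c"
      using mult_pair_right[OF c, of "geom b ?c n" "geom b ?c n"] Suc by simp_all
    have "?c \<diamondop> ?H \<oplus> ?H"
      using geom(2)[OF leq_refl[OF pair_closed(3)[OF b]]] H by simp
    from sum_exchange[OF b H(1) this] show ?case using H(2) by simp
  qed
  obtain h where h: "is_sup h (geom b ?c)" using sup_exists[of "geom b ?c"] g(3) by blast
  have "h \<diamondop> h" "is_sup (h \<oplus> h) (\<lambda>n. geom b ?c n \<oplus> geom b ?c n)"
    using is_sup_sum[OF h g(3) h g(3)] * by blast+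
  then show ?thesis
    unfolding halvable_def using * is_sup_unique[OF _ p, of "h \<oplus> h"] by auto
qed

text \<open>
  Writing \<open>a = a b + a b\<^sup>\<bottom>\<close> and \<open>b = a b + a\<^sup>\<bottom> b\<close> splits off the common part \<open>a b\<close>. Iterating on
  the remainders leaves remainders \<open>r\<close>, \<open>s\<close> with \<open>r s = 0\<close>, because the sum of the common parts
  converges.
\<close>

lemma common_part:
  assumes a: "a \<in> carrier M" and b: "b \<in> carrier M"
  obtains c r s where "c \<diamondop> r" "a = c \<oplus> r" "c \<diamondop> s" "b = c \<oplus> s" "r \<otimes> s = \<zero>"
proof -
  define t where "t = rec_nat (a, b, \<zero>) (\<lambda>_ (x, y, z). (x \<otimes> \<sim>y, \<sim>x \<otimes> y, z \<oplus> x \<otimes> y))"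
  define x y z where "x n = fst (t n)" and "y n = fst (snd (t n))" and "z n = snd (snd (t n))" for n
  have t0: "x 0 = a" "y 0 = b" "z 0 = \<zero>"
    by (simp_all add: x_def y_def z_def t_def)
  have tS: "x (Suc n) = x n \<otimes> \<sim>(y n)" "y (Suc n) = \<sim>(x n) \<otimes> y n" "z (Suc n) = z n \<oplus> x n \<otimes> y n" for n
    by (simp_all add: x_def y_def z_def t_def split_beta)
  have inv: "z n \<diamondop> x n \<and> z n \<oplus> x n = a \<and> z n \<diamondop> y n \<and> z n \<oplus> y n = b" for n
  proof (induction n)
    case 0
    then show ?case using a b by (simp add: t0 pair_zero)
  next
    case (Suc n)
    then have zx: "z n \<diamondop> x n" "z n \<oplus> x n = a" and zy: "z n \<diamondop> y n" "z n \<oplus> y n = b" by auto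
    have c: "x n \<in> carrier M" "y n \<in> carrier M" using zx zy by (auto dest: pair_closed)
    note r = mult_split_right[OF c(2,1)] and l = mult_split_left[OF c]
    show ?case
      using pair_assoc'[OF r(1), of "z n"] pair_assoc'[OF l(1), of "z n"] zx zy r(2) l(2)
      by (simp add: tS)
  qed
  have zx: "z n \<diamondop> x n" "z n \<oplus> x n = a" and zy: "z n \<diamondop> y n" "z n \<oplus> y n = b" for n
    using inv by blast+
  have cl: "x n \<in> carrier M" "y n \<in> carrier M" "z n \<in> carrier M" for n
    using zx(1) zy(1) pair_closed by blast+
  have zxy: "z n \<diamondop> x n \<otimes> y n" for n
    using pair_mono_right(1)[OF zx(1) mult_leq(1)[OF cl(1,2)]] .
  have inc: "z n \<preceq> z (Suc n)" for n using leq_sum(1)[OF zxy] by (simp add: tS)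
  obtain c where c: "is_sup c z" using sup_exists[of z] inc by blast
  have "c \<preceq> a" "c \<preceq> b"
    using leq_sum(1)[OF zx(1)] leq_sum(1)[OF zy(1)] is_sup_least[OF c] zx(2) zy(2) by auto
  then obtain r s where r: "c \<diamondop> r" "a = c \<oplus> r" and s: "c \<diamondop> s" "b = c \<oplus> s"
    by (elim leqE) blast
  \<comment> \<open>What remains beyond the limit \<open>c\<close> is below what remains beyond
    \<open>z n\<close>: \<open>z n \<oplus> w \<preceq> c \<oplus> w = z n \<oplus> v n\<close>, and
    \<open>z n\<close> cancels. Hence \<open>r \<otimes> s\<close> lies below
    \<open>x n \<otimes> y n\<close>, which is exactly the increment of \<open>z\<close>.\<close>
  have rest: "w \<preceq> v n" if cw: "c \<diamondop> w" "d = c \<oplus> w" and zv: "\<And>n. z n \<diamondop> v n" "\<And>n. z n \<oplus> v n = d"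
    for w v d n
    using pair_mono[OF is_sup_upper[OF c, of n] leq_refl[OF pair_closed(2)[OF cw(1)]] cw(1)]
      sum_cancel_leq[OF _ zv(1)[of n], of w] zv(2) cw(2) by simp
  have rs: "r \<otimes> s \<preceq> x n \<otimes> y n" for n
    using emult_mono[OF rest[OF r zx] rest[OF s zy]] .
  have "r \<otimes> s = \<zero>"
  proof (rule archimedean[of z])
    show "z n \<diamondop> r \<otimes> s" "z n \<oplus> r \<otimes> s \<preceq> z (Suc n)" for n
      using pair_mono_right[OF zxy rs] by (simp_all add: tS)
  qed
  with r s show ?thesis by (rule that)
qed

lemma idem_mult_remainder:
  assumes q: "idem q" and r: "c \<diamondop> r" and s: "c \<diamondop> s" "r \<otimes> s = \<zero>"
    and le: "q \<otimes> (c \<oplus> r) \<preceq> q \<otimes> (c \<oplus> s)"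
  shows "q \<otimes> r = \<zero>"
proof -
  have cl: "q \<in> carrier M" "r \<in> carrier M" "s \<in> carrier M"
    using q r s by (auto dest: pair_closed)
  have "q \<otimes> r \<preceq> q \<otimes> s"
    using sum_cancel_leq[of "q \<otimes> c" "q \<otimes> r" "q \<otimes> s"] le
    by (simp add: mult_pair_left[OF cl(1) r] mult_pair_left[OF cl(1) s(1)])
  then have "(q \<otimes> r) \<otimes> (q \<otimes> r) \<preceq> (q \<otimes> r) \<otimes> (q \<otimes> s)"
    using mult_mono_left cl by simp
  also have "(q \<otimes> r) \<otimes> (q \<otimes> s) = \<zero>"
    using idem_mult_mult[OF q cl(2,3)] s(2) cl by simp
  finally have "(q \<otimes> r) \<otimes> (q \<otimes> r) = \<zero>" by (rule leq_zero)
  then show ?thesis by (rule square_eq_zero[rotated]) (simp add: cl)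
qed

definition boolean :: "'a \<Rightarrow> bool"
  where "boolean p \<longleftrightarrow> (\<forall>x. x \<preceq> p \<longrightarrow> idem x)"

lemma boolean_or_halvable:
  assumes p: "idem p" "\<not> boolean p"
  obtains q where "idem q" "q \<preceq> p" "q \<noteq> \<zero>" "halvable q"
proof -
  obtain x where x: "x \<preceq> p" "\<not> idem x" using p by (auto simp: boolean_def)
  have cx: "x \<in> carrier M" "\<sim>x \<in> carrier M" using leq_closed[OF x(1)] by simp_all
  define b where "b = x \<otimes> \<sim>x"
  have b: "b \<preceq> x" "b \<preceq> \<sim>x" using mult_leq[OF cx] by (simp_all add: b_def)
  have b0: "b \<noteq> \<zero>" using idem_iff_mult_compl(1)[OF cx(1)] x by (simp add: b_def)
  have bb: "b \<diamondop> b" using pair_mono(1)[OF b pair_ocompl(1)[OF cx(1)]] .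
  have c: "b \<oplus> b \<in> carrier M" using bb by (rule pair_closed)
  obtain q where q: "is_sup q (geom (b \<oplus> b) (b \<oplus> b))" using ceiling_exists[OF c] by blast
  note qc = ceiling[OF q c]
  have cp: "p \<in> carrier M" "\<sim>p \<in> carrier M" using p by simp_all
  \<comment> \<open>To keep \<open>q\<close> below \<open>p\<close> it suffices that
    \<open>\<sim>p\<close> annihilates \<open>b\<close>: then it annihilates
    \<open>b \<oplus> b\<close> and so the ceiling \<open>q\<close>.\<close>
  have "b \<preceq> p" using leq_trans[OF b(1) x(1)] .
  then have "\<sim>p \<otimes> b \<preceq> \<sim>p \<otimes> p" by (rule mult_mono_left[OF cp(2)])
  also have "\<sim>p \<otimes> p = \<zero>" using idem_iff_mult_compl(2)[OF cp(1)] p(1) by blast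
  finally have "\<sim>p \<otimes> b \<preceq> \<zero>" .
  then have "\<sim>p \<otimes> (b \<oplus> b) = \<zero>"
    using mult_pair_left(2)[OF cp(2) bb] leq_zero[of "\<sim>p \<otimes> b"] by (simp add: pair_zero)
  then have "\<sim>p \<otimes> q = \<zero>" using mult_ceiling[OF q c cp(2)] by blast
  then have "p \<otimes> q = q" using mult_split_left(2)[of p q] qc cp by (simp add: pair_zero)
  then have "q \<preceq> p" using idem_leq_iff[OF p(1)] qc by simp
  moreover have "q \<noteq> \<zero>"
    using leq_trans[OF leq_sum(1)[OF bb] qc(2)] leq_zero b0 by blast
  ultimately show ?thesis using that qc(1) halvable_ceiling[OF bb q] by blast
qed

lemma leq_if_idem_mult_leq:
  assumes "a \<in> carrier M" "b \<in> carrier M"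
    and le: "\<And>q. idem q \<Longrightarrow> boolean q \<or> halvable q \<Longrightarrow> q \<otimes> a \<preceq> q \<otimes> b"
  shows "a \<preceq> b"
proof -
  obtain c r s where r: "c \<diamondop> r" "a = c \<oplus> r" and s: "c \<diamondop> s" "b = c \<oplus> s" "r \<otimes> s = \<zero>"
    using common_part[OF assms(1,2)] by blast
  have cr: "r \<in> carrier M" using r(1) by (rule pair_closed)
  obtain p where p: "is_sup p (geom r r)" using ceiling_exists[OF cr] by blast
  note pr = ceiling[OF p cr]
  have kill: "q = \<zero>" if q: "idem q" "q \<preceq> p" "boolean q \<or> halvable q" for q
  proof -
    have "q \<otimes> r = \<zero>"
      using idem_mult_remainder[OF q(1) r(1) s(1,3)] le[OF q(1,3)] r(2) s(2) by simp
    \<comment> \<open>Annihilation of \<open>r\<close> passes to its ceiling \<open>p\<close>,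
      whereas \<open>q \<preceq> p\<close> means \<open>p \<otimes> q = q\<close>; centrality makes
      the two collide.\<close>
    then have "q \<otimes> p = \<zero>" using mult_ceiling[OF p cr] q by simp
    then have "p \<otimes> q = \<zero>" using idem_central[OF q(1)] pr by simp
    then show ?thesis using idem_leq_iff[OF pr(1)] q by simp
  qed
  have "boolean p" using boolean_or_halvable[OF pr(1)] kill by blast
  then have "p = \<zero>" using kill pr leq_refl by simp
  then have "r = \<zero>" using pr leq_zero by blast
  then have "a = c" using r by (simp add: pair_zero pair_closed(1))
  then show ?thesis using s leq_sum(1) by blast
qed

end


section \<open>Multiples and scalars\<close>

context effect_algebra
begin

primrec multiple :: "nat \<Rightarrow> 'a \<Rightarrow> 'a" where
  "multiple 0 x = \<zero>"
| "multiple (Suc k) x = multiple k x \<oplus> x"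

text \<open>\<open>multiple\<close> is a total function and returns meaningless values once a sum is
  undefined; this predicate requires every addition on the way to \<open>multiple k x\<close> to be
  legitimate.\<close>

definition multiple_defined :: "nat \<Rightarrow> 'a \<Rightarrow> bool"
  where "multiple_defined k x \<longleftrightarrow> x \<in> carrier E \<and> (\<forall>j<k. multiple j x \<diamondop> x)"

lemma multiple_defined_Suc:
  "multiple_defined (Suc k) x \<longleftrightarrow> multiple_defined k x \<and> multiple k x \<diamondop> x"
  by (auto simp: multiple_defined_def less_Suc_eq)

lemma multiple_defined_mono: "multiple_defined k x \<Longrightarrow> j \<le> k \<Longrightarrow> multiple_defined j x"
  by (auto simp: multiple_defined_def)

lemma multiple_closed: "multiple_defined k x \<Longrightarrow> multiple k x \<in> carrier E"
  by (cases k) (auto simp: multiple_defined_Suc pair_closed)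

lemma multiple_add:
  assumes "multiple_defined (i + j) x"
  shows "multiple i x \<diamondop> multiple j x \<and> multiple (i + j) x = multiple i x \<oplus> multiple j x"
  using assms
proof (induction j)
  case 0
  then show ?case using multiple_closed[of i x] by (simp add: pair_zero)
next
  case (Suc j)
  then have IH: "multiple i x \<diamondop> multiple j x" "multiple (i + j) x = multiple i x \<oplus> multiple j x"
    and "multiple (i + j) x \<diamondop> x"
    by (simp_all add: multiple_defined_Suc)
  then have "multiple i x \<oplus> multiple j x \<diamondop> x" by simp
  from pair_assoc[OF IH(1) this] show ?case using IH(2) by simp
qed

lemma multiple_mono:
  assumes "multiple_defined k x" "j \<le> k" shows "multiple j x \<preceq> multiple k x"
  using multiple_add[of j "k - j" x] assms leq_sum(1)[of "multiple j x" "multiple (k - j) x"] by simp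

lemma multiple_double:
  assumes "y \<diamondop> y" "multiple_defined k (y \<oplus> y)"
  shows "multiple_defined (2 * k) y \<and> multiple (2 * k) y = multiple k (y \<oplus> y)"
  using assms(2)
proof (induction k)
  case 0
  then show ?case using assms(1) pair_closed(1) by (simp add: multiple_defined_def)
next
  case (Suc k)
  then have IH: "multiple_defined (2 * k) y" "multiple (2 * k) y = multiple k (y \<oplus> y)"
    and d: "multiple k (y \<oplus> y) \<diamondop> y \<oplus> y"
    by (simp_all add: multiple_defined_Suc)
  from pair_assoc'[OF assms(1) d] IH show ?case by (simp add: multiple_defined_Suc)
qed

text \<open>For \<open>j = 0\<close> the first hypothesis says nothing about
  \<open>multiple k x\<close>, whose membership in the carrier then rests on the second.\<close>

lemma multiple_multiple:
  assumes "multiple_defined (j * k) x" "multiple_defined k x"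
  shows "multiple_defined j (multiple k x) \<and> multiple j (multiple k x) = multiple (j * k) x"
  using assms(1)
proof (induction j)
  case 0
  then show ?case using multiple_closed[OF assms(2)] by (simp add: multiple_defined_def)
next
  case (Suc j)
  then have "multiple_defined (j * k + k) x" by (simp add: add.commute)
  from multiple_add[OF this] Suc show ?case
    using multiple_defined_mono[of "k + j * k" x "j * k"]
    by (simp add: multiple_defined_Suc add.commute)
qed

end

context effect_monoid
begin

lemma mult_multiple:
  assumes "a \<in> carrier M" "multiple_defined k x"
  shows "multiple_defined k (a \<otimes> x) \<and> a \<otimes> multiple k x = multiple k (a \<otimes> x)"
    "multiple_defined k (x \<otimes> a) \<and> multiple k x \<otimes> a = multiple k (x \<otimes> a)"
proof -
  show "multiple_defined k (a \<otimes> x) \<and> a \<otimes> multiple k x = multiple k (a \<otimes> x)"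
    using assms(2)
  proof (induction k)
    case 0
    then show ?case using assms(1) by (simp add: multiple_defined_def)
  next
    case (Suc k)
    then show ?case
      using mult_pair_left[OF assms(1), of "multiple k x" x] by (simp add: multiple_defined_Suc)
  qed
  show "multiple_defined k (x \<otimes> a) \<and> multiple k x \<otimes> a = multiple k (x \<otimes> a)"
    using assms(2)
  proof (induction k)
    case 0
    then show ?case using assms(1) by (simp add: multiple_defined_def)
  next
    case (Suc k)
    then show ?case
      using mult_pair_right[OF assms(1), of "multiple k x" x] by (simp add: multiple_defined_Suc)
  qed
qed

end

text \<open>The largest numerator \<open>k\<close> with \<open>k / 2 ^ n < t\<close>, and \<open>0\<close> for \<open>t = 0\<close>.\<close>

definition dyadic_below :: "real \<Rightarrow> nat \<Rightarrow> nat"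
  where "dyadic_below t n = nat (\<lceil>2 ^ n * t\<rceil> - 1)"

text \<open>Strictness matters: a dyadic fraction strictly below \<open>s + t\<close> or
  \<open>s * t\<close> is already reached by approximations of \<open>s\<close> and \<open>t\<close>
  at some finite level, while a fraction equal to it might never be. The price is that
  \<open>1\<close> itself is approximated only from below, a problem left to
  \<open>scalar_one\<close>.\<close>

lemma dyadic_below:
  assumes "0 \<le> t"
  shows "dyadic_below t n = 0 \<or> real (dyadic_below t n) < 2 ^ n * t"
    "real (dyadic_below t n) \<le> 2 ^ n * t"
    "2 ^ n * t - 1 \<le> real (dyadic_below t n)"
    "real k < 2 ^ n * t \<Longrightarrow> k \<le> dyadic_below t n"
proof -
  have nn: "0 \<le> 2 ^ n * t" using assms by simp
  show 1: "dyadic_below t n = 0 \<or> real (dyadic_below t n) < 2 ^ n * t"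
    unfolding dyadic_below_def by linarith
  show "real (dyadic_below t n) \<le> 2 ^ n * t" using 1 nn by auto
  show "2 ^ n * t - 1 \<le> real (dyadic_below t n)" unfolding dyadic_below_def by linarith
  show "k \<le> dyadic_below t n" if "real k < 2 ^ n * t"
    using that unfolding dyadic_below_def by linarith
qed

lemma dyadic_below_le:
  assumes "0 \<le> t" "t \<le> 1" shows "dyadic_below t n \<le> 2 ^ n"
proof -
  have "2 ^ n * t \<le> 2 ^ n * 1" using assms(2) by (intro mult_left_mono) simp_all
  then have "real (dyadic_below t n) \<le> real (2 ^ n)"
    using order_trans[OF dyadic_below(2)[OF assms(1)]] by fastforce
  then show ?thesis by (simp only: of_nat_le_iff)
qed

lemma dyadic_below_Suc:
  assumes "0 \<le> t" shows "2 * dyadic_below t n \<le> dyadic_below t (Suc n)"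
  using dyadic_below(1)[OF assms, of n] by (auto intro: dyadic_below(4)[OF assms])

lemma dyadic_below_one: "dyadic_below 1 n = 2 ^ n - 1"
  by (simp add: dyadic_below_def nat_diff_distrib nat_power_eq)

section \<open>Real scalars generated by a half of the unit\<close>

locale halved_effect_monoid = omega_effect_monoid M for M :: "('a, 'm) effect_monoid_scheme" (structure) +
  fixes h
  assumes half: "h \<diamondop> h" "h \<oplus> h = \<one>"
begin

primrec half_power :: "nat \<Rightarrow> 'a" where
  "half_power 0 = \<one>"
| "half_power (Suc n) = half_power n \<otimes> h"

lemma half_closed: "h \<in> carrier M"
  using half(1) by (rule pair_closed)

lemma half_power_closed [simp]: "half_power n \<in> carrier M"
  by (induction n) (simp_all add: half_closed)

lemma half_power_double:
  "half_power n \<otimes> h \<diamondop> half_power n \<otimes> h" "half_power n \<otimes> h \<oplus> half_power n \<otimes> h = half_power n"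
  using mult_pair_left[OF half_power_closed half(1), of n] by (simp_all add: half(2) emult_one)

lemma half_power_add: "half_power n \<otimes> half_power m = half_power (n + m)"
proof (induction m)
  case (Suc m)
  then show ?case using emult_assoc[of "half_power n" "half_power m" h] half_closed by simp
qed (simp add: emult_one)

text \<open>The element that plays the role of \<open>k / 2 ^ n\<close>, meaningful for
  \<open>k \<le> 2 ^ n\<close>.\<close>

definition dyadic :: "nat \<Rightarrow> nat \<Rightarrow> 'a"
  where "dyadic n k = multiple k (half_power n)"

lemma dyadic_defined: "k \<le> 2 ^ n \<Longrightarrow> multiple_defined k (half_power n)"
  and dyadic_full: "dyadic n (2 ^ n) = \<one>"
proof -
  have *: "multiple_defined (2 ^ n) (half_power n) \<and> multiple (2 ^ n) (half_power n) = \<one>" for n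
  proof (induction n)
    case 0
    then show ?case by (simp add: multiple_defined_def pair_zero)
  next
    case (Suc n)
    then show ?case
      using multiple_double[OF half_power_double(1)[of n], of "2 ^ n"] by (simp add: half_power_double)
  qed
  then show "k \<le> 2 ^ n \<Longrightarrow> multiple_defined k (half_power n)"
    using multiple_defined_mono by blast
  show "dyadic n (2 ^ n) = \<one>" using * by (simp add: dyadic_def)
qed

lemma dyadic_closed: "k \<le> 2 ^ n \<Longrightarrow> dyadic n k \<in> carrier M"
  unfolding dyadic_def by (intro multiple_closed dyadic_defined)

lemma dyadic_zero [simp]: "dyadic n 0 = \<zero>"
  by (simp add: dyadic_def)

lemma dyadic_add:
  "i + j \<le> 2 ^ n \<Longrightarrow> dyadic n i \<diamondop> dyadic n j" "i + j \<le> 2 ^ n \<Longrightarrow> dyadic n (i + j) = dyadic n i \<oplus> dyadic n j"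
  using multiple_add[OF dyadic_defined[of "i + j" n]] by (simp_all add: dyadic_def)

lemma dyadic_mult:
  assumes "i \<le> 2 ^ n" "j \<le> 2 ^ m"
  shows "dyadic n i \<otimes> dyadic m j = dyadic (n + m) (i * j)"
proof -
  \<comment> \<open>The separate bound on \<open>j\<close> is what \<open>multiple_multiple\<close>
    needs; it does not follow from the bound on \<open>i * j\<close> when
    \<open>i = 0\<close>.\<close>
  have "i * j \<le> 2 ^ (n + m)" "j \<le> 2 ^ (n + m)"
    using mult_mono'[OF assms] order_trans[OF assms(2), of "2 ^ (n + m)"] by (simp_all add: power_add)
  then have d: "multiple_defined (i * j) (half_power (n + m))" "multiple_defined j (half_power (n + m))"
    by (simp_all add: dyadic_defined)
  have "dyadic n i \<otimes> dyadic m j = multiple i (half_power n \<otimes> dyadic m j)"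
    using mult_multiple(2)[OF dyadic_closed[OF assms(2)] dyadic_defined[OF assms(1)]]
    by (simp add: dyadic_def)
  also have "half_power n \<otimes> dyadic m j = multiple j (half_power (n + m))"
    using mult_multiple(1)[OF half_power_closed[of n] dyadic_defined[OF assms(2)]]
    by (simp add: dyadic_def half_power_add)
  finally show ?thesis using multiple_multiple[OF d] by (simp add: dyadic_def)
qed

text \<open>Expanding the fraction by \<open>2 ^ m\<close> amounts to multiplying by
  \<open>dyadic m (2 ^ m)\<close>, which is the unit.\<close>

lemma dyadic_scale:
  assumes "k \<le> 2 ^ n" shows "dyadic (n + m) (2 ^ m * k) = dyadic n k"
proof -
  have "dyadic n k = dyadic n k \<otimes> dyadic m (2 ^ m)"
    using dyadic_closed[OF assms] by (simp add: dyadic_full emult_one)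
  then show ?thesis using dyadic_mult[OF assms order_refl, of m] by (simp add: mult.commute)
qed

text \<open>Both fractions are brought to the denominator \<open>2 ^ (n + m)\<close>, where the
  order is that of the numerators.\<close>

lemma dyadic_leq:
  assumes "j \<le> 2 ^ m" "k * 2 ^ m \<le> j * 2 ^ n" shows "dyadic n k \<preceq> dyadic m j"
proof -
  have "k * 2 ^ m \<le> 2 ^ n * 2 ^ m"
    using order_trans[OF assms(2) mult_right_mono[OF assms(1), of "2 ^ n"]] by (simp add: mult.commute)
  then have "k \<le> 2 ^ n" by simp
  then have "dyadic n k = dyadic (n + m) (2 ^ m * k)" "dyadic m j = dyadic (n + m) (2 ^ n * j)"
    using dyadic_scale[of k n m] dyadic_scale[OF assms(1), of n] by (simp_all add: add.commute)
  moreover have "2 ^ n * j \<le> 2 ^ (n + m)" using assms(1) by (simp add: power_add)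
  ultimately show ?thesis
    using multiple_mono[OF dyadic_defined, of "2 ^ n * j" "n + m" "2 ^ m * k"] assms(2)
    by (simp add: dyadic_def mult.commute)
qed

definition approx :: "real \<Rightarrow> nat \<Rightarrow> 'a"
  where "approx t n = dyadic n (dyadic_below t n)"

text \<open>The image of the real \<open>t\<close> in the effect monoid, meaningful on [0,1]. The
  convex action is left multiplication by it, so its laws reduce to additivity, multiplicativity and
  unitality of this map.\<close>

definition scalar :: "real \<Rightarrow> 'a"
  where "scalar t = (SOME s. is_sup s (approx t))"

lemma approx_mono:
  assumes "0 \<le> t" "t \<le> 1" shows "approx t n \<preceq> approx t (Suc n)"
  unfolding approx_def
proof (rule dyadic_leq[OF dyadic_below_le[OF assms]])
  show "dyadic_below t n * 2 ^ Suc n \<le> dyadic_below t (Suc n) * 2 ^ n"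
    using mult_right_mono[OF dyadic_below_Suc[OF assms(1), of n], of "2 ^ n"] by (simp add: mult_ac)
qed

lemma scalar_is_sup:
  assumes "0 \<le> t" "t \<le> 1" shows "is_sup (scalar t) (approx t)"
  unfolding scalar_def using sup_exists[of "approx t"] approx_mono[OF assms] by (metis someI)

lemma scalar_closed [simp]: "0 \<le> t \<Longrightarrow> t \<le> 1 \<Longrightarrow> scalar t \<in> carrier M"
  using scalar_is_sup is_sup_closed(1) by blast

lemma dyadic_leq_scalar:
  assumes "0 \<le> t" "t \<le> 1" "k = 0 \<or> real k < 2 ^ n * t" shows "dyadic n k \<preceq> scalar t"
proof -
  have "k \<le> dyadic_below t n" using assms(3) dyadic_below(4)[OF assms(1)] by auto
  then have "dyadic n k \<preceq> approx t n"
    unfolding approx_def using dyadic_below_le[OF assms(1,2)] by (intro dyadic_leq) simp_all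
  then show ?thesis using leq_trans is_sup_upper[OF scalar_is_sup[OF assms(1,2)]] by blast
qed

lemma two_power_gt: "0 < (d::real) \<Longrightarrow> \<exists>m. c \<le> 2 ^ m * d"
  using real_arch_pow[of 2 "c / d"] by (auto simp: field_simps intro: less_imp_le)

lemma scalar_add:
  assumes "0 \<le> s" "0 \<le> t" "s + t \<le> 1"
  shows "scalar s \<diamondop> scalar t" "scalar s \<oplus> scalar t = scalar (s + t)"
proof -
  have st: "s \<le> 1" "t \<le> 1" "0 \<le> s + t" using assms by simp_all
  let ?k = "dyadic_below s" and ?l = "dyadic_below t"
  have kl: "real (?k n + ?l n) \<le> 2 ^ n * (s + t)" for n
    using dyadic_below(2)[OF assms(1), of n] dyadic_below(2)[OF assms(2), of n]
    by (simp add: algebra_simps)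
  have kl': "?k n + ?l n \<le> 2 ^ n" for n
  proof -
    have "2 ^ n * (s + t) \<le> 2 ^ n * 1" using assms(3) by (intro mult_left_mono) simp_all
    then have "real (?k n + ?l n) \<le> real (2 ^ n)" using order_trans[OF kl] by fastforce
    then show ?thesis by (simp only: of_nat_le_iff)
  qed
  note add = dyadic_add[OF kl']
  have *: "scalar s \<diamondop> scalar t" "is_sup (scalar s \<oplus> scalar t) (\<lambda>n. approx s n \<oplus> approx t n)"
    using is_sup_sum[OF scalar_is_sup[OF assms(1) st(1)] approx_mono[OF assms(1) st(1)]
        scalar_is_sup[OF assms(2) st(2)] approx_mono[OF assms(2) st(2)]] add(1)
    by (simp_all add: approx_def)
  show "scalar s \<diamondop> scalar t" by fact
  have "dyadic n (?k n + ?l n) \<preceq> scalar (s + t)" for n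
  proof (rule dyadic_leq_scalar[OF st(3) assms(3)])
    show "?k n + ?l n = 0 \<or> real (?k n + ?l n) < 2 ^ n * (s + t)"
      using dyadic_below(1,2)[OF assms(1), of n] dyadic_below(1,2)[OF assms(2), of n]
      by (auto simp: algebra_simps)
  qed
  then have le: "scalar s \<oplus> scalar t \<preceq> scalar (s + t)"
    by (intro is_sup_least[OF *(2)]) (simp add: approx_def add(2)[symmetric])
  have "approx (s + t) n \<preceq> scalar s \<oplus> scalar t" for n
  proof (cases "dyadic_below (s + t) n = 0")
    case True
    then show ?thesis using pair_closed(3)[OF *(1)] by (simp add: approx_def zero_leq)
  next
    case False
    let ?K = "dyadic_below (s + t) n"
    have "real ?K < 2 ^ n * (s + t)" using False dyadic_below(1)[OF st(3), of n] by simp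
    then have "0 < s + t - ?K / 2 ^ n" by (simp add: field_simps)
    \<comment> \<open>Each of the two numerators at level \<open>m\<close> misses its exact value by
      at most 1, so a scaled gap of 2 is enough.\<close>
    then obtain m where m: "2 \<le> 2 ^ m * (s + t - ?K / 2 ^ n)" using two_power_gt by blast
    have "2 ^ m * (?K / 2 ^ n) \<le> real (?k m + ?l m)"
      using m dyadic_below(3)[OF assms(1), of m] dyadic_below(3)[OF assms(2), of m]
      by (simp add: algebra_simps)
    then have "real (?K * 2 ^ m) \<le> real ((?k m + ?l m) * 2 ^ n)" by (simp add: field_simps)
    then have "?K * 2 ^ m \<le> (?k m + ?l m) * 2 ^ n" by (simp only: of_nat_le_iff)
    then have "approx (s + t) n \<preceq> dyadic m (?k m + ?l m)"
      unfolding approx_def by (rule dyadic_leq[OF kl'])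
    also have "dyadic m (?k m + ?l m) = approx s m \<oplus> approx t m"
      by (simp add: approx_def add(2))
    finally show ?thesis using leq_trans is_sup_upper[OF *(2)] by blast
  qed
  then have "scalar (s + t) \<preceq> scalar s \<oplus> scalar t"
    by (rule is_sup_least[OF scalar_is_sup[OF st(3) assms(3)]])
  then show "scalar s \<oplus> scalar t = scalar (s + t)" using le leq_antisym by blast
qed

lemma scalar_mult:
  assumes s: "0 \<le> s" "s \<le> 1" and t: "0 \<le> t" "t \<le> 1"
  shows "scalar s \<otimes> scalar t = scalar (s * t)"
proof -
  have st: "0 \<le> s * t" "s * t \<le> 1" using assms mult_le_one by auto
  let ?k = "dyadic_below s" and ?l = "dyadic_below t"
  note S = scalar_is_sup[OF s] approx_mono[OF s] and T = scalar_is_sup[OF t] approx_mono[OF t]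
  note kl = dyadic_below_le[OF s] dyadic_below_le[OF t]
  have mult: "approx s n \<otimes> approx t m = dyadic (n + m) (?k n * ?l m)" for n m
    unfolding approx_def by (rule dyadic_mult[OF kl])
  have "approx s n \<otimes> approx t m \<preceq> scalar (s * t)" for n m
    unfolding mult
  proof (rule dyadic_leq_scalar[OF st])
    show "?k n * ?l m = 0 \<or> real (?k n * ?l m) < 2 ^ (n + m) * (s * t)"
    proof (cases "?k n = 0 \<or> ?l m = 0")
      case False
      then have "real (?k n) * real (?l m) < (2 ^ n * s) * (2 ^ m * t)"
        using dyadic_below(1)[OF s(1), of n] dyadic_below(1)[OF t(1), of m]
        by (intro mult_strict_mono) auto
      then show ?thesis by (simp add: power_add mult_ac)
    qed auto
  qed
  \<comment> \<open>The bound is carried to the limit in one factor at a time, because products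
    preserve suprema in each argument.\<close>
  then have "approx s n \<otimes> scalar t \<preceq> scalar (s * t)" for n
    using is_sup_mult(1)[OF is_sup_closed(2)[OF S(1)] T] is_sup_least by blast
  then have le: "scalar s \<otimes> scalar t \<preceq> scalar (s * t)"
    using is_sup_mult(2)[OF scalar_closed[OF t] S] is_sup_least by blast
  have "approx (s * t) n \<preceq> scalar s \<otimes> scalar t" for n
  proof (cases "dyadic_below (s * t) n = 0")
    case True
    then show ?thesis using s t by (simp add: approx_def zero_leq)
  next
    case False
    let ?K = "dyadic_below (s * t) n"
    have "real ?K < 2 ^ n * (s * t)" using False dyadic_below(1)[OF st(1), of n] by simp
    then have "0 < s * t - ?K / 2 ^ n" by (simp add: field_simps)
    \<comment> \<open>With \<open>k\<close> and \<open>l\<close> the numerators at level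
      \<open>m\<close>, \<open>(k + 1) * (l + 1)\<close> is at least \<open>4 ^ m * s * t\<close>.
      The excess \<open>k + l + 1\<close> over \<open>k * l\<close> is at most
      \<open>3 * 2 ^ m\<close>, so a gap of 3 at scale \<open>2 ^ m\<close> absorbs it.\<close>
    then obtain m where m: "3 \<le> 2 ^ m * (s * t - ?K / 2 ^ n)" using two_power_gt by blast
    have "(2 ^ m * s) * (2 ^ m * t) \<le> (real (?k m) + 1) * (real (?l m) + 1)"
      using dyadic_below(3)[OF s(1), of m] dyadic_below(3)[OF t(1), of m] s t
      by (intro mult_mono) auto
    moreover have "real (?k m) + real (?l m) + 1 \<le> 3 * 2 ^ m"
    proof -
      have "real (?k m) \<le> 2 ^ m" "real (?l m) \<le> 2 ^ m"
        using kl[of m] by simp_all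
      moreover have "1 \<le> (2::real) ^ m" by simp
      ultimately show ?thesis by linarith
    qed
    ultimately have "2 ^ m * 2 ^ m * (s * t) - 3 * 2 ^ m \<le> real (?k m * ?l m)"
      by (simp add: algebra_simps)
    moreover have "2 ^ m * 3 \<le> 2 ^ m * (2 ^ m * (s * t - ?K / 2 ^ n))"
      using m by (intro mult_left_mono) simp_all
    ultimately have "2 ^ m * 2 ^ m * (?K / 2 ^ n) \<le> real (?k m * ?l m)"
      by (simp add: algebra_simps)
    then have "real (?K * 2 ^ (m + m)) \<le> real ((?k m * ?l m) * 2 ^ n)"
      by (simp add: field_simps power_add)
    then have *: "?K * 2 ^ (m + m) \<le> (?k m * ?l m) * 2 ^ n" by (simp only: of_nat_le_iff)
    have "?k m * ?l m \<le> 2 ^ (m + m)" using mult_mono'[OF kl, of m m] by (simp add: power_add)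
    then have "approx (s * t) n \<preceq> approx s m \<otimes> approx t m"
      unfolding mult using * unfolding approx_def by (rule dyadic_leq)
    also have "approx s m \<otimes> approx t m \<preceq> scalar s \<otimes> scalar t"
      using emult_mono is_sup_upper[OF S(1)] is_sup_upper[OF T(1)] by blast
    finally (leq_trans) show ?thesis .
  qed
  then have "scalar (s * t) \<preceq> scalar s \<otimes> scalar t"
    by (rule is_sup_least[OF scalar_is_sup[OF st]])
  then show ?thesis using le leq_antisym by blast
qed

text \<open>The approximations are \<open>1 - 1 / 2 ^ n\<close>, so the complement of
  \<open>scalar 1\<close> lies below every \<open>half_power n\<close>. Consecutive approximations
  differ by \<open>half_power (Suc n)\<close>, so this complement can be added at each step and is
  zero.\<close>

lemma scalar_one: "scalar 1 = \<one>"
proof -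
  have S: "is_sup (scalar 1) (approx 1)" using scalar_is_sup[of 1] by simp
  have a: "approx 1 n \<diamondop> half_power n" "approx 1 n \<oplus> half_power n = \<one>" for n
  proof -
    have 1: "dyadic n 1 = half_power n" by (simp add: dyadic_def pair_zero)
    have 2: "(2 ^ n - 1) + 1 \<le> (2::nat) ^ n" "(2 ^ n - 1) + 1 = (2::nat) ^ n" by simp_all
    show "approx 1 n \<diamondop> half_power n" "approx 1 n \<oplus> half_power n = \<one>"
      using dyadic_add[OF 2(1)] unfolding 2(2) 1 dyadic_full approx_def dyadic_below_one by simp_all
  qed
  have x: "\<sim>(scalar 1) \<preceq> half_power n" for n
    using ocompl_antimono[OF is_sup_upper[OF S, of n]] ocompl_eqI[OF a(1,2), of n] by simp
  have "\<sim>(scalar 1) = \<zero>"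
  proof (rule archimedean[of "approx 1"])
    fix n
    have 1: "approx 1 n \<diamondop> half_power (Suc n) \<and> approx 1 n \<oplus> half_power (Suc n) = approx 1 (Suc n)"
    proof -
      have "1 \<le> (2::nat) ^ n" by simp
      then have *: "2 ^ Suc n - 1 = 2 * (2 ^ n - 1) + (1::nat)"
        and "2 * (2 ^ n - 1) + 1 \<le> (2::nat) ^ Suc n"
        unfolding power_Suc by linarith+
      note dyadic_add[OF this(2)]
      moreover have "dyadic (Suc n) (2 * (2 ^ n - 1)) = approx 1 n"
        using dyadic_scale[of "2 ^ n - 1" n 1] by (simp add: approx_def dyadic_below_one)
      moreover have "dyadic (Suc n) 1 = half_power (Suc n)"
        using half_power_closed[of "Suc n"] by (simp add: dyadic_def pair_zero)
      ultimately show ?thesis unfolding approx_def dyadic_below_one * by simp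
    qed
    show "approx 1 n \<diamondop> \<sim>(scalar 1)" "approx 1 n \<oplus> \<sim>(scalar 1) \<preceq> approx 1 (Suc n)"
      using pair_mono_right[OF conjunct1[OF 1] x] conjunct2[OF 1] by simp_all
  qed
  then show ?thesis using ocompl_ocompl[of "scalar 1"] ocompl_zero by simp
qed

lemma convex: "convex_effect_algebra M"
proof -
  have eff: "effect_algebra M" by unfold_locales
  show ?thesis
    unfolding convex_effect_algebra_def
  proof (intro conjI eff exI[of _ "\<lambda>r a. scalar r \<otimes> a"] ballI impI)
    fix r s :: real and a b
    assume r: "r \<in> {0..1}" and a: "a \<in> carrier M"
    then have R: "scalar r \<in> carrier M" by simp
    show "scalar r \<otimes> a \<in> carrier M" using R a by simp
    { assume s: "s \<in> {0..1}"
      then show "scalar r \<otimes> (scalar s \<otimes> a) = scalar (r * s) \<otimes> a"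
        using r a scalar_mult[of r s] emult_assoc[of "scalar r" "scalar s" a] by simp
      { assume rs: "r + s \<le> 1"
        then have "scalar r \<diamondop> scalar s" "scalar r \<oplus> scalar s = scalar (r + s)"
          using scalar_add r s by simp_all
        from mult_pair_right[OF a this(1)] this(2)
        show "scalar r \<otimes> a \<sharp> scalar s \<otimes> a" "scalar r \<otimes> a \<oplus> scalar s \<otimes> a = scalar (r + s) \<otimes> a"
          by (simp_all add: summable_pair_def) } }
    { assume "b \<in> carrier M" "a \<sharp> b"
      with a have "a \<diamondop> b" by (simp add: summable_pair_def)
      from mult_pair_left[OF R this]
      show "scalar r \<otimes> a \<sharp> scalar r \<otimes> b" "scalar r \<otimes> a \<oplus> scalar r \<otimes> b = scalar r \<otimes> (a \<oplus> b)"
        by (simp_all add: summable_pair_def) }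
  next
    fix a assume "a \<in> carrier M"
    then show "scalar 1 \<otimes> a = a" by (simp add: scalar_one one_emult)
  qed
qed

end


section \<open>Corners\<close>

text \<open>For an idempotent \<open>p\<close> the carrier is the down-set of \<open>p\<close>,
  written as an equation so that closure is a computation with products. Only the complement has to
  be made relative to \<open>p\<close>.\<close>

definition corner :: "('a, 'm) effect_monoid_scheme \<Rightarrow> 'a \<Rightarrow> 'a effect_monoid"
  where "corner M p =
    \<lparr>carrier = {x \<in> carrier M. p \<otimes>\<^bsub>M\<^esub> x = x}, ezero = \<zero>\<^bsub>M\<^esub>, orth = orth M, psum = psum M,
     ocompl = (\<lambda>x. p \<otimes>\<^bsub>M\<^esub> ocompl M x), emult = emult M\<rparr>"

lemma corner_simps [simp]:
  "carrier (corner M p) = {x \<in> carrier M. p \<otimes>\<^bsub>M\<^esub> x = x}"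
  "\<zero>\<^bsub>corner M p\<^esub> = \<zero>\<^bsub>M\<^esub>"
  "orth (corner M p) = orth M"
  "psum (corner M p) = psum M"
  "ocompl (corner M p) x = p \<otimes>\<^bsub>M\<^esub> ocompl M x"
  "emult (corner M p) = emult M"
  by (simp_all add: corner_def)

context effect_monoid
begin

lemma idem_mult_closed: "idem p \<Longrightarrow> a \<in> carrier M \<Longrightarrow> p \<otimes> a \<in> carrier (corner M p)"
  using emult_assoc[of p p a] by (simp add: idem_def)

lemma corner_one [simp]: "idem p \<Longrightarrow> \<one>\<^bsub>corner M p\<^esub> = p"
  by (simp add: eone_def) (simp add: eone_def[symmetric] emult_one)

lemma effect_monoid_corner:
  assumes p: "idem p" shows "effect_monoid (corner M p)"
proof -
  have pc: "p \<in> carrier M" and pp: "p \<otimes> p = p" using p by (simp_all add: idem_def)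
  have compl: "x \<diamondop> p \<otimes> \<sim>x" "x \<oplus> p \<otimes> \<sim>x = p" if "x \<in> carrier M" "p \<otimes> x = x" for x
    using mult_pair_left[OF pc pair_ocompl(1)[OF that(1)]] that
    by (simp_all add: pair_ocompl emult_one pc)
  have dist: "p \<otimes> (a \<oplus> b) = a \<oplus> b"
    if "a \<in> carrier M" "b \<in> carrier M" "p \<otimes> a = a" "p \<otimes> b = b" "a \<sharp> b" for a b
    using distrib_left[OF pc that(1,2,5)] that by simp
  show ?thesis
  proof (unfold_locales; unfold corner_simps corner_one[OF p] mem_Collect_eq; (elim conjE)?)
    \<comment> \<open>The sum \<open>a \<oplus> p\<close> is fixed by \<open>p\<close> and so lies
      below \<open>p\<close>; cancelling \<open>p\<close> leaves
      \<open>a \<preceq> \<zero>\<close>.\<close>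
    show "a = \<zero>" if "a \<in> carrier M" "p \<otimes> a = a" "a \<sharp> p" for a
    proof -
      have ap: "a \<diamondop> p" using that pc by (simp add: summable_pair_def)
      have "a \<oplus> p = p \<otimes> (a \<oplus> p)" using mult_pair_left(2)[OF pc ap] that pp by simp
      then have "a \<oplus> p \<preceq> p" using mult_leq(1)[OF pc pair_closed(3)[OF ap]] by simp
      then have "p \<oplus> a \<preceq> p \<oplus> \<zero>" using sum_comm[OF ap] pc by (simp add: pair_zero)
      then have "a \<preceq> \<zero>" by (rule sum_cancel_leq[OF pair_comm[OF ap] pair_zero(1)[OF pc]])
      then show ?thesis by (rule leq_zero)
    qed
    show "b = p \<otimes> \<sim>a"
      if "a \<in> carrier M" "p \<otimes> a = a" "b \<in> carrier M" "p \<otimes> b = b" "a \<sharp> b" "a \<oplus> b = p" for a b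
      using sum_cancel[OF _ compl(1), of a b] compl(2)[of a] that by (simp add: summable_pair_def)
  next
    show "\<zero> \<in> carrier M \<and> p \<otimes> \<zero> = \<zero>" using pc by simp
    show "p \<otimes> \<sim>a \<in> carrier M \<and> p \<otimes> (p \<otimes> \<sim>a) = p \<otimes> \<sim>a" if "a \<in> carrier M" for a
      using idem_mult_closed[OF p, of "\<sim>a"] that by simp
    fix a assume a: "a \<in> carrier M" "p \<otimes> a = a"
    show "a \<sharp> \<zero> \<and> a \<oplus> \<zero> = a" using psum_zero a by blast
    show "a \<sharp> p \<otimes> \<sim>a \<and> a \<oplus> p \<otimes> \<sim>a = p"
      using compl[OF a] by (simp add: summable_pair_def)
    show "p \<otimes> a = a" by fact
    show "a \<otimes> p = a" using idem_central[OF p a(1)] a(2) by simp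
    fix b assume b: "b \<in> carrier M" "p \<otimes> b = b"
    show "a \<otimes> b \<in> carrier M \<and> p \<otimes> (a \<otimes> b) = a \<otimes> b"
      using emult_assoc[OF pc a(1) b(1)] a b by simp
    show "a \<oplus> b \<in> carrier M \<and> p \<otimes> (a \<oplus> b) = a \<oplus> b" if "a \<sharp> b"
      using dist[OF a(1) b(1) a(2) b(2) that] psum_closed[OF a(1) b(1) that] by blast
    show "b \<sharp> a \<and> a \<oplus> b = b \<oplus> a" if "a \<sharp> b"
      using psum_comm[OF a(1) b(1) that] .
    fix c assume c: "c \<in> carrier M" "p \<otimes> c = c"
    show "b \<sharp> c \<and> a \<sharp> b \<oplus> c \<and> a \<oplus> b \<oplus> c = a \<oplus> (b \<oplus> c)" if "a \<sharp> b" "a \<oplus> b \<sharp> c"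
      using psum_assoc[OF a(1) b(1) c(1) that] .
    show "a \<otimes> b \<otimes> c = a \<otimes> (b \<otimes> c)"
      using emult_assoc[OF a(1) b(1) c(1)] .
    show "a \<otimes> b \<sharp> a \<otimes> c \<and> a \<otimes> (b \<oplus> c) = a \<otimes> b \<oplus> a \<otimes> c" if "b \<sharp> c"
      using distrib_left[OF a(1) b(1) c(1) that] .
    show "b \<otimes> a \<sharp> c \<otimes> a \<and> (b \<oplus> c) \<otimes> a = b \<otimes> a \<oplus> c \<otimes> a" if "b \<sharp> c"
      using distrib_right[OF a(1) b(1) c(1) that] .
  qed
qed

text \<open>The order of the corner demands a difference inside the corner. It is there
  automatically, since a difference \<open>c\<close> with \<open>b = a \<oplus> c\<close> satisfies
  \<open>c \<preceq> b \<preceq> p\<close>.\<close>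

lemma corner_leq:
  assumes p: "idem p"
  shows "effect_algebra.leq (corner M p) a b \<longleftrightarrow>
    a \<in> carrier (corner M p) \<and> b \<in> carrier (corner M p) \<and> a \<preceq> b"
proof -
  interpret C: effect_monoid "corner M p" by (rule effect_monoid_corner[OF p])
  show ?thesis
  proof (intro iffI conjI; (elim conjE)?)
    assume *: "C.leq a b"
    then show "a \<in> carrier (corner M p)" "b \<in> carrier (corner M p)" by (rule C.leq_closed)+
    from * show "a \<preceq> b" unfolding C.leq_def C.summable_pair_def leq_def summable_pair_def by auto
  next
    assume ab: "a \<in> carrier (corner M p)" "b \<in> carrier (corner M p)" "a \<preceq> b"
    obtain c where c: "a \<diamondop> c" "b = a \<oplus> c" using ab(3) by (rule leqE)
    have "c \<preceq> b" using leq_sum(2) c by blast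
    moreover have "b \<preceq> p" using ab idem_leq_iff[OF p] by simp
    ultimately have "p \<otimes> c = c" using leq_trans idem_leq_iff[OF p] leq_closed by blast
    then show "C.leq a b"
      using ab(1) c unfolding C.leq_def C.summable_pair_def summable_pair_def by auto
  qed
qed

end

text \<open>A supremum taken in the whole monoid stays in the corner, because \<open>p\<close> is
  itself an upper bound.\<close>

lemma (in omega_effect_monoid) omega_effect_monoid_corner:
  assumes p: "idem p" shows "omega_effect_monoid (corner M p)"
proof -
  interpret C: effect_monoid "corner M p" by (rule effect_monoid_corner[OF p])
  note leq = corner_leq[OF p]
  have "\<exists>s. C.is_sup s x" if x: "\<forall>n. C.leq (x n) (x (Suc n))" for x
  proof -
    have xc: "x n \<in> carrier (corner M p)" and xp: "x n \<preceq> p" for n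
      using C.leq_closed(1)[OF x[rule_format]] idem_leq_iff[OF p] by simp_all
    obtain s where s: "is_sup s x" using sup_exists[of x] x leq by blast
    have "s \<preceq> p" using is_sup_least[OF s xp] .
    then have sc: "s \<in> carrier (corner M p)"
      using idem_leq_iff[OF p] is_sup_closed(1)[OF s] by simp
    have "C.is_sup s x"
      unfolding C.is_sup_def leq using xc sc is_sup_upper[OF s] is_sup_least[OF s] by blast
    then show ?thesis by blast
  qed
  then have "omega_complete (effect_order (corner M p))" unfolding C.omega_complete_iff by blast
  then show ?thesis by unfold_locales
qed

lemma (in omega_effect_monoid) convex_corner:
  assumes p: "idem p" "halvable p" shows "convex_effect_algebra (corner M p)"
proof -
  interpret C: omega_effect_monoid "corner M p" by (rule omega_effect_monoid_corner[OF p(1)])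
  obtain h where h: "h \<diamondop> h" "p = h \<oplus> h" using p(2) by (auto simp: halvable_def)
  have "h \<preceq> p" using leq_sum(1)[OF h(1)] h(2) by simp
  then have "h \<in> carrier (corner M p)" using idem_leq_iff[OF p(1)] pair_closed(1)[OF h(1)] by simp
  then interpret C: halved_effect_monoid "corner M p" h
    using h(1) h(2)[symmetric] p(1) by unfold_locales (simp_all add: C.summable_pair_def summable_pair_def)
  show ?thesis by (rule C.convex)
qed


section \<open>Products\<close>

text \<open>Extensional functions make elements equal as soon as they agree on \<open>I\<close>, as
  the equational axioms require.\<close>

definition product :: "'i set \<Rightarrow> ('i \<Rightarrow> 'a effect_monoid) \<Rightarrow> ('i \<Rightarrow> 'a) effect_monoid"
  where "product I F =
    \<lparr>carrier = (\<Pi>\<^sub>E i\<in>I. carrier (F i)), ezero = (\<lambda>i\<in>I. \<zero>\<^bsub>F i\<^esub>),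
     orth = (\<lambda>f g. \<forall>i\<in>I. f i \<sharp>\<^bsub>F i\<^esub> g i), psum = (\<lambda>f g. \<lambda>i\<in>I. f i \<oplus>\<^bsub>F i\<^esub> g i),
     ocompl = (\<lambda>f. \<lambda>i\<in>I. ocompl (F i) (f i)), emult = (\<lambda>f g. \<lambda>i\<in>I. f i \<otimes>\<^bsub>F i\<^esub> g i)\<rparr>"

lemma product_simps [simp]:
  "carrier (product I F) = (\<Pi>\<^sub>E i\<in>I. carrier (F i))"
  "\<zero>\<^bsub>product I F\<^esub> = (\<lambda>i\<in>I. \<zero>\<^bsub>F i\<^esub>)"
  "f \<sharp>\<^bsub>product I F\<^esub> g \<longleftrightarrow> (\<forall>i\<in>I. f i \<sharp>\<^bsub>F i\<^esub> g i)"
  "f \<oplus>\<^bsub>product I F\<^esub> g = (\<lambda>i\<in>I. f i \<oplus>\<^bsub>F i\<^esub> g i)"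
  "ocompl (product I F) f = (\<lambda>i\<in>I. ocompl (F i) (f i))"
  "f \<otimes>\<^bsub>product I F\<^esub> g = (\<lambda>i\<in>I. f i \<otimes>\<^bsub>F i\<^esub> g i)"
  by (simp_all add: product_def)

lemma product_one [simp]: "\<one>\<^bsub>product I F\<^esub> = (\<lambda>i\<in>I. \<one>\<^bsub>F i\<^esub>)"
  unfolding eone_def by (auto simp: fun_eq_iff)

lemma effect_monoid_product:
  assumes F: "\<And>i. i \<in> I \<Longrightarrow> effect_monoid (F i)" shows "effect_monoid (product I F)"
proof -
  have alg: "effect_algebra (F i)" if "i \<in> I" for i
    using F[OF that] by (simp add: effect_monoid_def)
  show ?thesis
  proof (unfold_locales; unfold product_simps product_one)
    show "(\<lambda>i\<in>I. \<zero>\<^bsub>F i\<^esub>) \<in> (\<Pi>\<^sub>E i\<in>I. carrier (F i))"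
      using effect_algebra.zero_closed[OF alg] by auto
  next
    fix a assume a: "a \<in> (\<Pi>\<^sub>E i\<in>I. carrier (F i))"
    then have m: "\<And>i. i \<in> I \<Longrightarrow> a i \<in> carrier (F i)" by auto
    have a': "\<And>i. i \<notin> I \<Longrightarrow> a i = undefined" using a by (rule PiE_arb)
    show "(\<lambda>i\<in>I. ocompl (F i) (a i)) \<in> (\<Pi>\<^sub>E i\<in>I. carrier (F i))"
      using effect_algebra.ocompl_closed[OF alg m] by auto
    show "(\<forall>i\<in>I. a i \<sharp>\<^bsub>F i\<^esub> (\<lambda>i\<in>I. \<zero>\<^bsub>F i\<^esub>) i) \<and> (\<lambda>i\<in>I. a i \<oplus>\<^bsub>F i\<^esub> (\<lambda>i\<in>I. \<zero>\<^bsub>F i\<^esub>) i) = a"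
      using effect_algebra.psum_zero[OF alg m] a' by (auto simp: fun_eq_iff restrict_def)
    show "(\<forall>i\<in>I. a i \<sharp>\<^bsub>F i\<^esub> (\<lambda>i\<in>I. ocompl (F i) (a i)) i) \<and>
        (\<lambda>i\<in>I. a i \<oplus>\<^bsub>F i\<^esub> (\<lambda>i\<in>I. ocompl (F i) (a i)) i) = (\<lambda>i\<in>I. \<one>\<^bsub>F i\<^esub>)"
      using effect_algebra.psum_ocompl[OF alg m] by (auto simp: fun_eq_iff)
    show "a = (\<lambda>i\<in>I. \<zero>\<^bsub>F i\<^esub>)" if "\<forall>i\<in>I. a i \<sharp>\<^bsub>F i\<^esub> (\<lambda>i\<in>I. \<one>\<^bsub>F i\<^esub>) i"
      using effect_algebra.orth_one[OF alg m] that a' by (auto simp: fun_eq_iff restrict_def)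
    show "(\<lambda>i\<in>I. (\<lambda>i\<in>I. \<one>\<^bsub>F i\<^esub>) i \<otimes>\<^bsub>F i\<^esub> a i) = a"
      using effect_monoid.one_emult[OF F m] a' by (auto simp: fun_eq_iff restrict_def)
    show "(\<lambda>i\<in>I. a i \<otimes>\<^bsub>F i\<^esub> (\<lambda>i\<in>I. \<one>\<^bsub>F i\<^esub>) i) = a"
      using effect_monoid.emult_one[OF F m] a' by (auto simp: fun_eq_iff restrict_def)
    fix b assume b: "b \<in> (\<Pi>\<^sub>E i\<in>I. carrier (F i))"
    then have n: "\<And>i. i \<in> I \<Longrightarrow> b i \<in> carrier (F i)" by auto
    have b': "\<And>i. i \<notin> I \<Longrightarrow> b i = undefined" using b by (rule PiE_arb)
    show "(\<lambda>i\<in>I. a i \<otimes>\<^bsub>F i\<^esub> b i) \<in> (\<Pi>\<^sub>E i\<in>I. carrier (F i))"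
      using effect_monoid.emult_closed[OF F m n] by auto
    show "b = (\<lambda>i\<in>I. ocompl (F i) (a i))"
      if "\<forall>i\<in>I. a i \<sharp>\<^bsub>F i\<^esub> b i" "(\<lambda>i\<in>I. a i \<oplus>\<^bsub>F i\<^esub> b i) = (\<lambda>i\<in>I. \<one>\<^bsub>F i\<^esub>)"
    proof -
      have "a i \<oplus>\<^bsub>F i\<^esub> b i = \<one>\<^bsub>F i\<^esub>" if "i \<in> I" for i
        using fun_cong[OF \<open>(\<lambda>i\<in>I. a i \<oplus>\<^bsub>F i\<^esub> b i) = _\<close>, of i] that by simp
      then show ?thesis
        using effect_algebra.ocompl_unique[OF alg m n] that(1) b' by (auto simp: fun_eq_iff restrict_def)
    qed
    { assume ab: "\<forall>i\<in>I. a i \<sharp>\<^bsub>F i\<^esub> b i"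
      show "(\<lambda>i\<in>I. a i \<oplus>\<^bsub>F i\<^esub> b i) \<in> (\<Pi>\<^sub>E i\<in>I. carrier (F i))"
        using effect_algebra.psum_closed[OF alg m n] ab by auto
      show "(\<forall>i\<in>I. b i \<sharp>\<^bsub>F i\<^esub> a i) \<and> (\<lambda>i\<in>I. a i \<oplus>\<^bsub>F i\<^esub> b i) = (\<lambda>i\<in>I. b i \<oplus>\<^bsub>F i\<^esub> a i)"
        using effect_algebra.psum_comm[OF alg m n] ab by (auto simp: fun_eq_iff) }
    fix c assume c: "c \<in> (\<Pi>\<^sub>E i\<in>I. carrier (F i))"
    then have k: "\<And>i. i \<in> I \<Longrightarrow> c i \<in> carrier (F i)" by auto
    show "(\<lambda>i\<in>I. (\<lambda>i\<in>I. a i \<otimes>\<^bsub>F i\<^esub> b i) i \<otimes>\<^bsub>F i\<^esub> c i) = (\<lambda>i\<in>I. a i \<otimes>\<^bsub>F i\<^esub> (\<lambda>i\<in>I. b i \<otimes>\<^bsub>F i\<^esub> c i) i)"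
      using effect_monoid.emult_assoc[OF F m n k] by (auto simp: fun_eq_iff)
    { assume ab: "\<forall>i\<in>I. a i \<sharp>\<^bsub>F i\<^esub> b i" and "\<forall>i\<in>I. (\<lambda>i\<in>I. a i \<oplus>\<^bsub>F i\<^esub> b i) i \<sharp>\<^bsub>F i\<^esub> c i"
      then have "\<And>i. i \<in> I \<Longrightarrow> a i \<oplus>\<^bsub>F i\<^esub> b i \<sharp>\<^bsub>F i\<^esub> c i" by simp
      then show "(\<forall>i\<in>I. b i \<sharp>\<^bsub>F i\<^esub> c i) \<and> (\<forall>i\<in>I. a i \<sharp>\<^bsub>F i\<^esub> (\<lambda>i\<in>I. b i \<oplus>\<^bsub>F i\<^esub> c i) i) \<and>
          (\<lambda>i\<in>I. (\<lambda>i\<in>I. a i \<oplus>\<^bsub>F i\<^esub> b i) i \<oplus>\<^bsub>F i\<^esub> c i) = (\<lambda>i\<in>I. a i \<oplus>\<^bsub>F i\<^esub> (\<lambda>i\<in>I. b i \<oplus>\<^bsub>F i\<^esub> c i) i)"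
        using effect_algebra.psum_assoc[OF alg m n k] ab by (auto simp: fun_eq_iff) }
    { assume bc: "\<forall>i\<in>I. b i \<sharp>\<^bsub>F i\<^esub> c i"
      show "(\<forall>i\<in>I. (\<lambda>i\<in>I. a i \<otimes>\<^bsub>F i\<^esub> b i) i \<sharp>\<^bsub>F i\<^esub> (\<lambda>i\<in>I. a i \<otimes>\<^bsub>F i\<^esub> c i) i) \<and>
          (\<lambda>i\<in>I. a i \<otimes>\<^bsub>F i\<^esub> (\<lambda>i\<in>I. b i \<oplus>\<^bsub>F i\<^esub> c i) i) =
          (\<lambda>i\<in>I. (\<lambda>i\<in>I. a i \<otimes>\<^bsub>F i\<^esub> b i) i \<oplus>\<^bsub>F i\<^esub> (\<lambda>i\<in>I. a i \<otimes>\<^bsub>F i\<^esub> c i) i)"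
        using effect_monoid.distrib_left[OF F m n k] bc by (auto simp: fun_eq_iff)
      show "(\<forall>i\<in>I. (\<lambda>i\<in>I. b i \<otimes>\<^bsub>F i\<^esub> a i) i \<sharp>\<^bsub>F i\<^esub> (\<lambda>i\<in>I. c i \<otimes>\<^bsub>F i\<^esub> a i) i) \<and>
          (\<lambda>i\<in>I. (\<lambda>i\<in>I. b i \<oplus>\<^bsub>F i\<^esub> c i) i \<otimes>\<^bsub>F i\<^esub> a i) =
          (\<lambda>i\<in>I. (\<lambda>i\<in>I. b i \<otimes>\<^bsub>F i\<^esub> a i) i \<oplus>\<^bsub>F i\<^esub> (\<lambda>i\<in>I. c i \<otimes>\<^bsub>F i\<^esub> a i) i)"
        using effect_monoid.distrib_right[OF F m n k] bc by (auto simp: fun_eq_iff) }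
  qed
qed

text \<open>From right to left, a difference has to be chosen in every coordinate and assembled into
  one function.\<close>

lemma product_leq:
  assumes F: "\<And>i. i \<in> I \<Longrightarrow> effect_monoid (F i)"
  shows "effect_algebra.leq (product I F) f g \<longleftrightarrow>
    f \<in> carrier (product I F) \<and> g \<in> carrier (product I F) \<and> (\<forall>i\<in>I. effect_algebra.leq (F i) (f i) (g i))"
proof -
  interpret P: effect_monoid "product I F" by (rule effect_monoid_product[OF F])
  have alg: "effect_algebra (F i)" if "i \<in> I" for i
    using F[OF that] by (simp add: effect_monoid_def)
  note leq = effect_algebra.leq_def[OF alg] effect_algebra.summable_pair_def[OF alg]
  show ?thesis
  proof (intro iffI conjI; (elim conjE)?)
    assume *: "P.leq f g"
    then show "f \<in> carrier (product I F)" "g \<in> carrier (product I F)" by (rule P.leq_closed)+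
    from * obtain c where "P.summable_pair f c" "g = f \<oplus>\<^bsub>product I F\<^esub> c" by (rule P.leqE)
    then show "\<forall>i\<in>I. effect_algebra.leq (F i) (f i) (g i)"
      by (auto simp: leq P.summable_pair_def)
  next
    assume f: "f \<in> carrier (product I F)" and g: "g \<in> carrier (product I F)"
      and *: "\<forall>i\<in>I. effect_algebra.leq (F i) (f i) (g i)"
    then have "\<forall>i\<in>I. \<exists>c. c \<in> carrier (F i) \<and> f i \<sharp>\<^bsub>F i\<^esub> c \<and> g i = f i \<oplus>\<^bsub>F i\<^esub> c"
      by (auto simp: leq)
    then obtain c where c: "\<forall>i\<in>I. c i \<in> carrier (F i) \<and> f i \<sharp>\<^bsub>F i\<^esub> c i \<and> g i = f i \<oplus>\<^bsub>F i\<^esub> c i"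
      by (rule bchoice[THEN exE])
    have "P.summable_pair f (\<lambda>i\<in>I. c i)"
      using c f by (simp add: P.summable_pair_def)
    moreover have "g i = undefined" if "i \<notin> I" for i
      using g that by (simp add: PiE_arb[of g I])
    then have "g = f \<oplus>\<^bsub>product I F\<^esub> (\<lambda>i\<in>I. c i)"
      using c by (simp add: fun_eq_iff restrict_def)
    ultimately show "P.leq f g" by (auto simp: P.leq_def)
  qed
qed

lemma omega_effect_monoid_product:
  assumes F: "\<And>i. i \<in> I \<Longrightarrow> omega_effect_monoid (F i)"
  shows "omega_effect_monoid (product I F)"
proof -
  have mon: "effect_monoid (F i)" if "i \<in> I" for i
    using F[OF that] by (simp add: omega_effect_monoid_def)
  have alg: "effect_algebra (F i)" if "i \<in> I" for i
    using mon[OF that] by (simp add: effect_monoid_def)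
  interpret P: effect_monoid "product I F" by (rule effect_monoid_product[OF mon])
  have leq: "P.leq f g \<longleftrightarrow> f \<in> carrier (product I F) \<and> g \<in> carrier (product I F) \<and>
      (\<forall>i\<in>I. effect_algebra.leq (F i) (f i) (g i))" for f g
    by (rule product_leq[OF mon])
  have "\<exists>s. P.is_sup s x" if x: "\<forall>n. P.leq (x n) (x (Suc n))" for x
  proof -
    have xc: "x n \<in> carrier (product I F)" for n
      using P.leq_closed(1) x by blast
    have "\<exists>s. effect_algebra.is_sup (F i) s (\<lambda>n. x n i)" if i: "i \<in> I" for i
    proof -
      have "effect_algebra.leq (F i) (x n i) (x (Suc n) i)" for n
        using x i leq by blast
      then show ?thesis
        using omega_effect_monoid.sup_exists[OF F[OF i], of "\<lambda>n. x n i"] by blast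
    qed
    then obtain s where s: "effect_algebra.is_sup (F i) (s i) (\<lambda>n. x n i)" if "i \<in> I" for i
      by metis
    let ?s = "\<lambda>i\<in>I. s i"
    have sc: "?s \<in> carrier (product I F)"
      using effect_algebra.is_sup_closed(1)[OF alg s] by auto
    have "P.is_sup ?s x"
      unfolding P.is_sup_def leq
      using xc sc effect_algebra.is_sup_upper[OF alg s] effect_algebra.is_sup_least[OF alg s] by auto
    then show ?thesis by blast
  qed
  then have "omega_complete (effect_order (product I F))" unfolding P.omega_complete_iff by blast
  then show ?thesis by unfold_locales
qed

text \<open>Convexity only asserts that some action exists, so one is chosen for each factor and all
  are applied coordinatewise.\<close>

lemma convex_product:
  assumes mon: "\<And>i. i \<in> I \<Longrightarrow> effect_monoid (F i)"
    and conv: "\<And>i. i \<in> I \<Longrightarrow> convex_effect_algebra (F i)"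
  shows "convex_effect_algebra (product I F)"
proof -
  have P: "effect_algebra (product I F)"
    using effect_monoid_product[of I F] mon by (simp add: effect_monoid_def)
  have "\<forall>i\<in>I. \<exists>act. (\<forall>r \<in> {0..1}. \<forall>a \<in> carrier (F i). act r a \<in> carrier (F i)) \<and>
      (\<forall>r \<in> {0..1}. \<forall>s \<in> {0..1}. \<forall>a \<in> carrier (F i). act r (act s a) = act (r * s) a) \<and>
      (\<forall>r \<in> {0..1}. \<forall>s \<in> {0..1}. \<forall>a \<in> carrier (F i). r + s \<le> 1 \<longrightarrow>
        act r a \<sharp>\<^bsub>F i\<^esub> act s a \<and> act r a \<oplus>\<^bsub>F i\<^esub> act s a = act (r + s) a) \<and>
      (\<forall>r \<in> {0..1}. \<forall>a \<in> carrier (F i). \<forall>b \<in> carrier (F i). a \<sharp>\<^bsub>F i\<^esub> b \<longrightarrow>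
        act r a \<sharp>\<^bsub>F i\<^esub> act r b \<and> act r a \<oplus>\<^bsub>F i\<^esub> act r b = act r (a \<oplus>\<^bsub>F i\<^esub> b)) \<and>
      (\<forall>a \<in> carrier (F i). act (1::real) a = a)"
    using conv unfolding convex_effect_algebra_def by blast
  then obtain A where A: "\<forall>i\<in>I. (\<forall>r \<in> {0..1}. \<forall>a \<in> carrier (F i). A i r a \<in> carrier (F i)) \<and>
      (\<forall>r \<in> {0..1}. \<forall>s \<in> {0..1}. \<forall>a \<in> carrier (F i). A i r (A i s a) = A i (r * s) a) \<and>
      (\<forall>r \<in> {0..1}. \<forall>s \<in> {0..1}. \<forall>a \<in> carrier (F i). r + s \<le> 1 \<longrightarrow>
        A i r a \<sharp>\<^bsub>F i\<^esub> A i s a \<and> A i r a \<oplus>\<^bsub>F i\<^esub> A i s a = A i (r + s) a) \<and>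
      (\<forall>r \<in> {0..1}. \<forall>a \<in> carrier (F i). \<forall>b \<in> carrier (F i). a \<sharp>\<^bsub>F i\<^esub> b \<longrightarrow>
        A i r a \<sharp>\<^bsub>F i\<^esub> A i r b \<and> A i r a \<oplus>\<^bsub>F i\<^esub> A i r b = A i r (a \<oplus>\<^bsub>F i\<^esub> b)) \<and>
      (\<forall>a \<in> carrier (F i). A i (1::real) a = a)"
    by (rule bchoice[THEN exE])
  show ?thesis
    unfolding convex_effect_algebra_def
  proof (intro conjI P exI[of _ "\<lambda>r f. \<lambda>i\<in>I. A i r (f i)"] ballI impI; unfold product_simps)
    fix r s :: real and f g
    assume r: "r \<in> {0..1}" and "f \<in> (\<Pi>\<^sub>E i\<in>I. carrier (F i))"
    then have f: "\<And>i. i \<in> I \<Longrightarrow> f i \<in> carrier (F i)" by auto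
    show "(\<lambda>i\<in>I. A i r (f i)) \<in> (\<Pi>\<^sub>E i\<in>I. carrier (F i))" using A r f by auto
    { assume s: "s \<in> {0..1}"
      then show "(\<lambda>i\<in>I. A i r ((\<lambda>i\<in>I. A i s (f i)) i)) = (\<lambda>i\<in>I. A i (r * s) (f i))"
        using A r f by (auto simp: fun_eq_iff)
      assume "r + s \<le> 1"
      then show "\<forall>i\<in>I. (\<lambda>i\<in>I. A i r (f i)) i \<sharp>\<^bsub>F i\<^esub> (\<lambda>i\<in>I. A i s (f i)) i"
        "(\<lambda>i\<in>I. (\<lambda>i\<in>I. A i r (f i)) i \<oplus>\<^bsub>F i\<^esub> (\<lambda>i\<in>I. A i s (f i)) i) = (\<lambda>i\<in>I. A i (r + s) (f i))"
        using A r s f by (auto simp: fun_eq_iff) }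
    { assume "g \<in> (\<Pi>\<^sub>E i\<in>I. carrier (F i))" and fg: "\<forall>i\<in>I. f i \<sharp>\<^bsub>F i\<^esub> g i"
      then have g: "\<And>i. i \<in> I \<Longrightarrow> g i \<in> carrier (F i)" by auto
      show "\<forall>i\<in>I. (\<lambda>i\<in>I. A i r (f i)) i \<sharp>\<^bsub>F i\<^esub> (\<lambda>i\<in>I. A i r (g i)) i"
        "(\<lambda>i\<in>I. (\<lambda>i\<in>I. A i r (f i)) i \<oplus>\<^bsub>F i\<^esub> (\<lambda>i\<in>I. A i r (g i)) i) =
          (\<lambda>i\<in>I. A i r ((\<lambda>i\<in>I. f i \<oplus>\<^bsub>F i\<^esub> g i) i))"
        using A r f g fg by (auto simp: fun_eq_iff) }
  next
    fix f assume f: "f \<in> (\<Pi>\<^sub>E i\<in>I. carrier (F i))"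
    have "(\<lambda>i\<in>I. A i 1 (f i)) i = f i" for i
      using A PiE_mem[OF f, of i] PiE_arb[OF f, of i] by (cases "i \<in> I") simp_all
    then show "(\<lambda>i\<in>I. A i 1 (f i)) = f" by (rule ext)
  qed
qed


section \<open>Effect monoids of idempotents\<close>

lemma effect_order_simps [simp]:
  "carrier (effect_order E) = carrier E" "(.=\<^bsub>effect_order E\<^esub>) = (=)"
  by (simp_all add: effect_order_def)

locale idempotent_effect_monoid = effect_monoid M for M :: "('a, 'm) effect_monoid_scheme" (structure) +
  assumes all_idem: "x \<in> carrier M \<Longrightarrow> idem x"
begin

text \<open>\<open>c = c \<otimes> c \<preceq> a \<otimes> b\<close>, so the product is the
  meet.\<close>

lemma mult_greatest: "c \<preceq> a \<Longrightarrow> c \<preceq> b \<Longrightarrow> c \<preceq> a \<otimes> b"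
  using emult_mono[of c a c b] all_idem[OF leq_closed(1), of c a] by (simp add: idem_def)

lemma pair_iff_mult_eq_zero:
  assumes "a \<in> carrier M" "b \<in> carrier M" shows "a \<diamondop> b \<longleftrightarrow> a \<otimes> b = \<zero>"
proof
  assume "a \<diamondop> b"
  then have "a \<preceq> \<sim>b" using pair_iff_leq_ocompl[OF assms(2,1)] pair_comm by blast
  then have "a \<otimes> b \<preceq> \<sim>b \<otimes> b" by (rule mult_mono_right[OF assms(2)])
  also have "\<sim>b \<otimes> b = \<zero>" using idem_iff_mult_compl(2) all_idem assms(2) by blast
  finally show "a \<otimes> b = \<zero>" by (rule leq_zero)
qed (rule pair_if_mult_eq_zero[OF assms])

text \<open>Elements below \<open>u\<close> are those fixed by \<open>u\<close>, and multiplication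
  by \<open>u\<close> distributes over the sum. Thus a defined sum is a join.\<close>

lemma sum_least:
  assumes "a \<diamondop> b" "a \<preceq> u" "b \<preceq> u" shows "a \<oplus> b \<preceq> u"
proof -
  have u: "u \<in> carrier M" using assms(2) by (rule leq_closed)
  note idem_leq_iff[OF all_idem[OF u]]
  then show ?thesis
    using assms mult_pair_left(2)[OF u assms(1)] leq_closed pair_closed by simp
qed

text \<open>A join of arbitrary elements is obtained by first making them disjoint: the part
  \<open>\<sim>a \<otimes> b\<close> of \<open>b\<close> outside \<open>a\<close> is added to
  \<open>a\<close>. It still dominates
  \<open>b = a \<otimes> b \<oplus> \<sim>a \<otimes> b\<close>.\<close>

lemma join_sum:
  assumes "a \<in> carrier M" "b \<in> carrier M"
  shows "a \<diamondop> \<sim>a \<otimes> b" "a \<preceq> a \<oplus> \<sim>a \<otimes> b" "b \<preceq> a \<oplus> \<sim>a \<otimes> b"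
    "a \<preceq> u \<Longrightarrow> b \<preceq> u \<Longrightarrow> a \<oplus> \<sim>a \<otimes> b \<preceq> u"
proof -
  have na: "\<sim>a \<in> carrier M" using assms(1) by simp
  show d: "a \<diamondop> \<sim>a \<otimes> b"
    using pair_mono_right(1)[OF pair_ocompl(1)[OF assms(1)] mult_leq(1)[OF na assms(2)]] .
  then show "a \<preceq> a \<oplus> \<sim>a \<otimes> b" by (rule leq_sum)
  show "b \<preceq> a \<oplus> \<sim>a \<otimes> b"
    using pair_mono(2)[OF mult_leq(1)[OF assms] leq_refl d] pair_closed(2)[OF d]
      mult_split_left(2)[OF assms] by simp
  show "a \<oplus> \<sim>a \<otimes> b \<preceq> u" if "a \<preceq> u" "b \<preceq> u"
    using sum_least[OF d that(1) leq_trans[OF mult_leq(2)[OF na assms(2)] that(2)]] .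
qed

lemma le_iff: "\<lbrakk>a \<in> carrier M; b \<in> carrier M\<rbrakk> \<Longrightarrow> a \<sqsubseteq>\<^bsub>effect_order M\<^esub> b \<longleftrightarrow> a \<preceq> b"
  by (rule effect_order_le_iff)

lemma bounded_lattice_effect_order: "bounded_lattice (effect_order M)"
proof (unfold_locales; unfold effect_order_simps)
  fix x y assume xy: "x \<in> carrier M" "y \<in> carrier M"
  have "least (effect_order M) (x \<oplus> \<sim>x \<otimes> y) (Upper (effect_order M) {x, y})"
    using xy join_sum[OF xy] pair_closed(3)[OF join_sum(1)[OF xy]]
    by (intro least_UpperI) (auto simp: le_iff Upper_def)
  then show "\<exists>s. least (effect_order M) s (Upper (effect_order M) {x, y})" by blast
  have "greatest (effect_order M) (x \<otimes> y) (Lower (effect_order M) {x, y})"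
    using xy mult_leq[OF xy] mult_greatest
    by (intro greatest_LowerI) (auto simp: le_iff Lower_def)
  then show "\<exists>s. greatest (effect_order M) s (Lower (effect_order M) {x, y})" by blast
next
  show "\<exists>x. least (effect_order M) x (carrier M)"
    by (rule exI[of _ \<zero>]) (auto simp: least_def le_iff zero_leq)
  show "\<exists>x. greatest (effect_order M) x (carrier M)"
    by (rule exI[of _ \<one>]) (auto simp: greatest_def le_iff leq_one)
qed (auto simp: le_iff leq_refl intro: leq_antisym leq_trans)

sublocale B: bounded_lattice "effect_order M"
  by (rule bounded_lattice_effect_order)

lemma meet_eq [simp]:
  assumes "x \<in> carrier M" "y \<in> carrier M" shows "x \<sqinter>\<^bsub>effect_order M\<^esub> y = x \<otimes> y"
proof -
  have m: "x \<sqinter>\<^bsub>effect_order M\<^esub> y \<in> carrier M" using B.meet_closed[of x y] assms by simp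
  have "x \<sqinter>\<^bsub>effect_order M\<^esub> y \<preceq> x" "x \<sqinter>\<^bsub>effect_order M\<^esub> y \<preceq> y"
    using B.meet_left[of x y] B.meet_right[of x y] assms m by (simp_all add: le_iff)
  moreover have "x \<otimes> y \<preceq> x \<sqinter>\<^bsub>effect_order M\<^esub> y"
    using B.meet_le[of "x \<otimes> y" x y] mult_leq[OF assms] assms m by (simp add: le_iff)
  ultimately show ?thesis using mult_greatest leq_antisym by blast
qed

lemma join_eq:
  assumes "x \<in> carrier M" "y \<in> carrier M" shows "x \<squnion>\<^bsub>effect_order M\<^esub> y = x \<oplus> \<sim>x \<otimes> y"
proof -
  have m: "x \<squnion>\<^bsub>effect_order M\<^esub> y \<in> carrier M" using B.join_closed[of x y] assms by simp
  have "x \<preceq> x \<squnion>\<^bsub>effect_order M\<^esub> y" "y \<preceq> x \<squnion>\<^bsub>effect_order M\<^esub> y"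
    using B.join_left[of x y] B.join_right[of x y] assms m by (simp_all add: le_iff)
  moreover have "x \<squnion>\<^bsub>effect_order M\<^esub> y \<preceq> x \<oplus> \<sim>x \<otimes> y"
    using B.join_le[of x "x \<oplus> \<sim>x \<otimes> y" y] join_sum[OF assms] assms m
      pair_closed(3)[OF join_sum(1)[OF assms]] by (simp add: le_iff)
  ultimately show ?thesis using join_sum(4)[OF assms] leq_antisym by blast
qed

lemma join_eq_sum:
  assumes "x \<diamondop> y" shows "x \<squnion>\<^bsub>effect_order M\<^esub> y = x \<oplus> y"
proof -
  have c: "x \<in> carrier M" "y \<in> carrier M" using assms by (auto dest: pair_closed)
  have "x \<oplus> \<sim>x \<otimes> y = x \<oplus> y"
    using sum_least[OF assms] join_sum[OF c] leq_sum[OF assms] leq_antisym by blast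
  then show ?thesis using join_eq[OF c] by simp
qed

lemma bottom_eq: "\<bottom>\<^bsub>effect_order M\<^esub> = \<zero>"
  by (rule leq_zero, subst le_iff[symmetric]) (use B.bottom_lower[of \<zero>] B.bottom_closed in simp_all)

lemma top_eq: "\<top>\<^bsub>effect_order M\<^esub> = \<one>"
proof (rule leq_antisym)
  have c: "\<top>\<^bsub>effect_order M\<^esub> \<in> carrier M" using B.top_closed by simp
  then show "\<top>\<^bsub>effect_order M\<^esub> \<preceq> \<one>" by (rule leq_one)
  show "\<one> \<preceq> \<top>\<^bsub>effect_order M\<^esub>" using B.top_higher[of \<one>] le_iff[OF one_closed c] by simp
qed

text \<open>Meets are products and the join of \<open>y\<close> and \<open>z\<close> is a sum, so
  the nontrivial half of lattice distributivity comes from distributing \<open>x\<close> over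
  \<open>y \<oplus> \<sim>y \<otimes> z\<close>.\<close>

lemma boolean_algebra_on: "boolean_algebra_on (effect_order M)"
proof
  fix x y z assume "x \<in> carrier (effect_order M)" "y \<in> carrier (effect_order M)"
    "z \<in> carrier (effect_order M)"
  then have x: "x \<in> carrier M" and y: "y \<in> carrier M" and z: "z \<in> carrier M" by simp_all
  have xy: "x \<otimes> y \<in> carrier M" and xz: "x \<otimes> z \<in> carrier M" using x y z by simp_all
  let ?u = "x \<otimes> y \<oplus> \<sim>(x \<otimes> y) \<otimes> (x \<otimes> z)"
  note yz = join_sum[OF y z] and j = join_sum[OF xy xz]
  have yzc: "y \<oplus> \<sim>y \<otimes> z \<in> carrier M" using yz(1) by (rule pair_closed)
  have "x \<otimes> (\<sim>y \<otimes> z) \<preceq> x \<otimes> z"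
    using mult_mono_left[OF x mult_leq(2)[of "\<sim>y" z]] y z by simp
  then have "x \<otimes> (\<sim>y \<otimes> z) \<preceq> ?u" using j(3) leq_trans by blast
  then have 1: "x \<otimes> (y \<oplus> \<sim>y \<otimes> z) \<preceq> ?u"
    using mult_pair_left[OF x yz(1)] sum_least[of "x \<otimes> y" "x \<otimes> (\<sim>y \<otimes> z)" ?u] j(2) by simp
  have 2: "?u \<preceq> x \<otimes> (y \<oplus> \<sim>y \<otimes> z)"
    using j(4) mult_mono_left[OF x yz(2)] mult_mono_left[OF x yz(3)] by blast
  show "x \<sqinter>\<^bsub>effect_order M\<^esub> (y \<squnion>\<^bsub>effect_order M\<^esub> z) =
      (x \<sqinter>\<^bsub>effect_order M\<^esub> y) \<squnion>\<^bsub>effect_order M\<^esub> (x \<sqinter>\<^bsub>effect_order M\<^esub> z)"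
    using leq_antisym[OF 1 2] x y z xy xz yzc by (simp add: join_eq)
next
  fix x assume "x \<in> carrier (effect_order M)"
  then have x: "x \<in> carrier M" by simp
  have "x \<otimes> \<sim>x = \<zero>" using idem_iff_mult_compl(1)[OF x] all_idem[OF x] by blast
  then show "\<exists>y\<in>carrier (effect_order M).
      x \<sqinter>\<^bsub>effect_order M\<^esub> y = \<bottom>\<^bsub>effect_order M\<^esub> \<and> x \<squnion>\<^bsub>effect_order M\<^esub> y = \<top>\<^bsub>effect_order M\<^esub>"
    using x join_eq_sum[OF pair_ocompl(1)[OF x]] pair_ocompl(2)[OF x]
    by (intro bexI[of _ "\<sim>x"]) (simp_all add: bottom_eq top_eq)
qed

text \<open>The effect monoid rebuilt from the order need not equal \<open>M\<close> as a record, as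
  the underlying total operations may differ outside the meaningful arguments. Equality of the
  orders is enough to transfer suprema and order reflection.\<close>

lemma leq_boolean_effect_monoid:
  "effect_algebra.leq (boolean_effect_monoid (effect_order M)) a b \<longleftrightarrow> a \<preceq> b"
proof -
  interpret BA: boolean_algebra_on "effect_order M" by (rule boolean_algebra_on)
  interpret N: effect_monoid "boolean_effect_monoid (effect_order M)"
    by (rule BA.effect_monoid_boolean)
  have c: "carrier (boolean_effect_monoid (effect_order M)) = carrier M"
    by (simp add: boolean_effect_monoid_def)
  show ?thesis
  proof (cases "a \<in> carrier M \<and> b \<in> carrier M")
    case True
    then show ?thesis
      using BA.effect_order_boolean[of a b] N.effect_order_le_iff[of a b] le_iff[of a b] by (simp add: c)
  next
    case False
    then show ?thesis using leq_closed N.leq_closed c by blast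
  qed
qed

lemma omega_complete_boolean_effect_monoid:
  assumes "omega_complete (effect_order M)"
  shows "omega_complete (effect_order (boolean_effect_monoid (effect_order M)))"
proof -
  interpret BA: boolean_algebra_on "effect_order M" by (rule boolean_algebra_on)
  interpret N: effect_monoid "boolean_effect_monoid (effect_order M)"
    by (rule BA.effect_monoid_boolean)
  show ?thesis
    using assms
    unfolding N.omega_complete_iff N.is_sup_def leq_boolean_effect_monoid omega_complete_iff is_sup_def .
qed

lemma boolean_effect_monoid_simps:
  "carrier (boolean_effect_monoid (effect_order M)) = carrier M"
  "\<one>\<^bsub>boolean_effect_monoid (effect_order M)\<^esub> = \<one>"
  "a \<diamondop> b \<Longrightarrow> a \<sharp>\<^bsub>boolean_effect_monoid (effect_order M)\<^esub> b"
  "a \<diamondop> b \<Longrightarrow> a \<oplus>\<^bsub>boolean_effect_monoid (effect_order M)\<^esub> b = a \<oplus> b"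
  "a \<in> carrier M \<Longrightarrow> b \<in> carrier M \<Longrightarrow> a \<otimes>\<^bsub>boolean_effect_monoid (effect_order M)\<^esub> b = a \<otimes> b"
proof -
  interpret BA: boolean_algebra_on "effect_order M" by (rule boolean_algebra_on)
  note d = boolean_effect_monoid_def
  show "carrier (boolean_effect_monoid (effect_order M)) = carrier M" by (simp add: d)
  show "\<one>\<^bsub>boolean_effect_monoid (effect_order M)\<^esub> = \<one>"
    using BA.complement_bottom unfolding eone_def[of "boolean_effect_monoid _"] by (simp add: d top_eq)
  show "a \<otimes>\<^bsub>boolean_effect_monoid (effect_order M)\<^esub> b = a \<otimes> b"
    if "a \<in> carrier M" "b \<in> carrier M" for a b using that by (simp add: d)
  assume ab: "a \<diamondop> b"
  then show "a \<oplus>\<^bsub>boolean_effect_monoid (effect_order M)\<^esub> b = a \<oplus> b"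
    by (simp add: d join_eq_sum)
  show "a \<sharp>\<^bsub>boolean_effect_monoid (effect_order M)\<^esub> b"
    using ab pair_closed(1,2)[OF ab] pair_iff_mult_eq_zero[of a b] by (simp add: d bottom_eq)
qed

end

lemma idempotent_effect_monoid_product:
  assumes "\<And>i. i \<in> I \<Longrightarrow> idempotent_effect_monoid (F i)"
  shows "idempotent_effect_monoid (product I F)"
proof -
  have mon: "effect_monoid (F i)" if "i \<in> I" for i
    using assms[OF that] by (simp add: idempotent_effect_monoid_def)
  interpret P: effect_monoid "product I F" by (rule effect_monoid_product[OF mon])
  show ?thesis
  proof
    fix x assume x: "x \<in> carrier (product I F)"
    then have xP: "x \<in> (\<Pi>\<^sub>E i\<in>I. carrier (F i))" by simp
    have "x i \<otimes>\<^bsub>F i\<^esub> x i = x i" if "i \<in> I" for i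
      using idempotent_effect_monoid.all_idem[OF assms[OF that] PiE_mem[OF xP that]]
        effect_monoid.idem_def[OF mon[OF that]] by blast
    then have "(\<lambda>i\<in>I. x i \<otimes>\<^bsub>F i\<^esub> x i) i = x i" for i
      using PiE_arb[OF xP, of i] by (cases "i \<in> I") simp_all
    then have "(\<lambda>i\<in>I. x i \<otimes>\<^bsub>F i\<^esub> x i) = x" by (rule ext)
    then show "P.idem x" using x by (simp add: P.idem_def)
  qed
qed

lemma (in omega_effect_monoid) idempotent_corner:
  assumes p: "idem p" "boolean p" shows "idempotent_effect_monoid (corner M p)"
proof -
  interpret C: effect_monoid "corner M p" by (rule effect_monoid_corner[OF p(1)])
  show ?thesis
  proof
    fix x assume x: "x \<in> carrier (corner M p)"
    then have "idem x" using p idem_leq_iff[OF p(1)] by (simp add: boolean_def)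
    then show "C.idem x" using x by (simp add: C.idem_def idem_def)
  qed
qed

text \<open>Both factors are products of corners indexed by idempotents of \<open>M\<close>, which
  is why their elements are functions from \<open>'a\<close> to \<open>'a\<close>.\<close>

theorem theorem54:
  fixes M :: "'a effect_monoid"
  assumes "effect_monoid M"
    and "omega_complete (effect_order M)"
  shows "\<exists>(M1 :: ('a \<Rightarrow> 'a) effect_monoid) (M2 :: ('a \<Rightarrow> 'a) effect_monoid) (B :: ('a \<Rightarrow> 'a) gorder).
    effect_monoid M1 \<and> omega_complete (effect_order M1) \<and> convex_effect_algebra M1 \<and>
    effect_monoid M2 \<and> omega_complete (effect_order M2) \<and>
    boolean_algebra_on B \<and> omega_complete B \<and> M2 = boolean_effect_monoid B \<and>
    (\<exists>f. effect_monoid_embedding M (direct_sum M1 M2) f)"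
proof -
  interpret M: effect_monoid M by fact
  interpret M: omega_effect_monoid M using assms(2) by unfold_locales
  define H where "H = {p. M.idem p \<and> M.halvable p}"
  define K where "K = {p. M.idem p \<and> M.boolean p}"
  define M1 where "M1 = product H (corner M)"
  define P where "P = product K (corner M)"
  \<comment> \<open>\<open>P\<close> already has a Boolean order, but the second factor must
    literally be the effect monoid of a Boolean algebra, so it is rebuilt from that order.\<close>
  define M2 where "M2 = boolean_effect_monoid (effect_order P)"
  have idem: "M.idem p" if "p \<in> H \<or> p \<in> K" for p using that by (auto simp: H_def K_def)
  interpret M1: omega_effect_monoid M1
    unfolding M1_def using M.omega_effect_monoid_corner idem
    by (intro omega_effect_monoid_product) blast
  interpret P: omega_effect_monoid P
    unfolding P_def using M.omega_effect_monoid_corner idem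
    by (intro omega_effect_monoid_product) blast
  interpret P: idempotent_effect_monoid P
    unfolding P_def using M.idempotent_corner
    by (intro idempotent_effect_monoid_product) (simp add: K_def)
  interpret B: boolean_algebra_on "effect_order P" by (rule P.boolean_algebra_on)
  interpret M2: effect_monoid M2 unfolding M2_def by (rule B.effect_monoid_boolean)
  have conv: "convex_effect_algebra M1"
    unfolding M1_def using M.convex_corner M.effect_monoid_corner
    by (intro convex_product) (auto simp: H_def)
  \<comment> \<open>The family of all corner projections. It is treated for an arbitrary set
    \<open>I\<close> of idempotents, so that one argument serves \<open>H\<close> and
    \<open>K\<close>.\<close>
  define e where "e I a = (\<lambda>p\<in>I. p \<otimes>\<^bsub>M\<^esub> a)" for I a
  have e: "e I a \<in> carrier (product I (corner M))" "e I \<one>\<^bsub>M\<^esub> = \<one>\<^bsub>product I (corner M)\<^esub>"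
    "b \<in> carrier M \<Longrightarrow> e I (a \<otimes>\<^bsub>M\<^esub> b) = e I a \<otimes>\<^bsub>product I (corner M)\<^esub> e I b"
    "M.summable_pair a b \<Longrightarrow> e I a \<sharp>\<^bsub>product I (corner M)\<^esub> e I b"
    "M.summable_pair a b \<Longrightarrow> e I (a \<oplus>\<^bsub>M\<^esub> b) = e I a \<oplus>\<^bsub>product I (corner M)\<^esub> e I b"
    "effect_algebra.leq (product I (corner M)) (e I a) (e I b) \<Longrightarrow>
      \<forall>p\<in>I. M.leq (p \<otimes>\<^bsub>M\<^esub> a) (p \<otimes>\<^bsub>M\<^esub> b)"
    if a: "a \<in> carrier M" and "\<forall>p\<in>I. M.idem p" for I a b
  proof -
    have I: "\<And>p. p \<in> I \<Longrightarrow> M.idem p" using that by blast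
    show "e I a \<in> carrier (product I (corner M))"
      using M.idem_mult_closed[OF I a] by (auto simp: e_def)
    show "e I \<one>\<^bsub>M\<^esub> = \<one>\<^bsub>product I (corner M)\<^esub>"
      using I by (auto simp: e_def fun_eq_iff restrict_def M.emult_one)
    show "e I (a \<otimes>\<^bsub>M\<^esub> b) = e I a \<otimes>\<^bsub>product I (corner M)\<^esub> e I b" if "b \<in> carrier M"
      using M.idem_mult_mult[OF I a that] by (auto simp: e_def fun_eq_iff restrict_def)
    show "e I a \<sharp>\<^bsub>product I (corner M)\<^esub> e I b"
      "e I (a \<oplus>\<^bsub>M\<^esub> b) = e I a \<oplus>\<^bsub>product I (corner M)\<^esub> e I b" if "M.summable_pair a b"
      using M.mult_pair_left[OF M.idem_closed[OF I] that]
      by (auto simp: e_def fun_eq_iff restrict_def M.summable_pair_def)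
    show "\<forall>p\<in>I. M.leq (p \<otimes>\<^bsub>M\<^esub> a) (p \<otimes>\<^bsub>M\<^esub> b)"
      if le: "effect_algebra.leq (product I (corner M)) (e I a) (e I b)"
    proof
      fix p assume p: "p \<in> I"
      have "effect_algebra.leq (corner M p) (e I a p) (e I b p)"
        using product_leq[of I "corner M"] M.effect_monoid_corner I le p by blast
      then show "M.leq (p \<otimes>\<^bsub>M\<^esub> a) (p \<otimes>\<^bsub>M\<^esub> b)"
        using M.corner_leq[OF I[OF p]] p by (simp add: e_def)
    qed
  qed
  have HK: "\<forall>p\<in>H. M.idem p" "\<forall>p\<in>K. M.idem p" using idem by blast+
  note eH = e[where I = H, OF _ HK(1), folded M1_def]
    and eK = e[where I = K, OF _ HK(2), folded P_def]
  note M2s = P.boolean_effect_monoid_simps[folded M2_def]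
  have "effect_monoid_embedding M (direct_sum M1 M2) (\<lambda>a. (e H a, e K a))"
    unfolding effect_monoid_embedding_def
  proof (intro conjI ballI impI)
    interpret S: effect_monoid "direct_sum M1 M2"
      by (rule effect_monoid_direct_sum) unfold_locales
    have Sc: "carrier (direct_sum M1 M2) = carrier M1 \<times> carrier M2" by (simp add: direct_sum_def)
    show f: "(\<lambda>a. (e H a, e K a)) \<in> carrier M \<rightarrow> carrier (direct_sum M1 M2)"
      using eH(1) eK(1) by (simp add: Sc M2s)
    show "(e H \<one>\<^bsub>M\<^esub>, e K \<one>\<^bsub>M\<^esub>) = \<one>\<^bsub>direct_sum M1 M2\<^esub>"
      using eH(2)[OF M.one_closed] eK(2)[OF M.one_closed] M2s(2)
      unfolding eone_def[of "direct_sum M1 M2"] by (simp add: direct_sum_def eone_def)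
    fix a b assume a: "a \<in> carrier M" and b: "b \<in> carrier M"
    show "(e H (a \<otimes>\<^bsub>M\<^esub> b), e K (a \<otimes>\<^bsub>M\<^esub> b)) = (e H a, e K a) \<otimes>\<^bsub>direct_sum M1 M2\<^esub> (e H b, e K b)"
      using eH(3)[OF a b] eK(3)[OF a b] M2s(5)[OF eK(1)[OF a] eK(1)[OF b]]
      by (simp add: direct_sum_def)
    { assume "a \<sharp>\<^bsub>M\<^esub> b"
      then have ab: "M.summable_pair a b" using a b by (simp add: M.summable_pair_def)
      then have "P.summable_pair (e K a) (e K b)"
        using eK(1)[OF a] eK(1)[OF b] eK(4)[OF a ab] by (simp add: P.summable_pair_def)
      then show "(e H a, e K a) \<sharp>\<^bsub>direct_sum M1 M2\<^esub> (e H b, e K b)"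
        "(e H (a \<oplus>\<^bsub>M\<^esub> b), e K (a \<oplus>\<^bsub>M\<^esub> b)) = (e H a, e K a) \<oplus>\<^bsub>direct_sum M1 M2\<^esub> (e H b, e K b)"
        using eH(4,5)[OF a ab] eK(5)[OF a ab] M2s(3,4)[of "e K a" "e K b"]
        by (simp_all add: direct_sum_def) }
    assume "(e H a, e K a) \<sqsubseteq>\<^bsub>effect_order (direct_sum M1 M2)\<^esub> (e H b, e K b)"
    then have "M1.leq (e H a) (e H b)" "M2.leq (e K a) (e K b)"
      using eH(1)[OF a] eH(1)[OF b] eK(1)[OF a] eK(1)[OF b] M2s(1)
      by (auto simp: effect_order_def direct_sum_def M1.leq_def M2.leq_def
          M1.summable_pair_def M2.summable_pair_def)
    then have le: "M1.leq (e H a) (e H b)" "P.leq (e K a) (e K b)"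
      by (simp_all only: P.leq_boolean_effect_monoid[folded M2_def])
    have "M.leq a b"
    proof (rule M.leq_if_idem_mult_leq[OF a b])
      fix p assume "M.idem p" "M.boolean p \<or> M.halvable p"
      then have "p \<in> H \<or> p \<in> K" by (auto simp: H_def K_def)
      then show "M.leq (p \<otimes>\<^bsub>M\<^esub> a) (p \<otimes>\<^bsub>M\<^esub> b)"
        using eH(6)[OF a le(1), rule_format] eK(6)[OF a le(2), rule_format] by (elim disjE)
    qed
    then show "a \<sqsubseteq>\<^bsub>effect_order M\<^esub> b" by (rule iffD2[OF M.effect_order_le_iff[OF a b]])
  qed
  moreover have "omega_complete (effect_order M2)"
    unfolding M2_def by (rule P.omega_complete_boolean_effect_monoid[OF P.omega])
  ultimately show ?thesis
    using M1.effect_monoid_axioms M1.omega conv M2.effect_monoid_axioms B.boolean_algebra_on_axioms P.omega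
      M2_def by blast
qed

end
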